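(* Let $\boldsymbol X=(X_1,\dots,X_n)$ be a random vector with independent components taking values in a product space $\boldsymbol S=S_1\times\cdots\times S_n$. Let $m>0$ be an integer and $\alpha\ge0$. Suppose $f$ is a bounded measurable real function on $\boldsymbol S$ such that $$\max_{v\in[m],\ j\in[n]}\ \sum_{V\in\binom{[n]}{v}:\ j\in V}\Delta_V(f)\le\alpha .$$ Then $$\mathbf E\bigl[e^{f(\boldsymbol X)}\bigr]=(1+\delta)^n\exp\left(\sum_{r=1}^m\frac{\kappa_r(f(\boldsymbol X))}{r!}\right),$$ where $\delta>-1$ satisfies $|\delta|\le e^{(100\alpha)^{m+1}}-1$. Furthermore, for any $r\in[m]$, $$|\kappa_r(f(\boldsymbol X))|\le n\,\frac{(r-1)!}{50\,r}\,(80\alpha)^r .$$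
   Context: For a positive integer $k$, $[k]=\{1,\dots,k\}$, and $\binom{[n]}{v}$ is the set of $v$-element subsets of $[n]$. For $\boldsymbol y\in\boldsymbol S$ and $j\in[n]$, the operator $R^j_{\boldsymbol y}$ acts on functions $f:\boldsymbol S\to\mathbb R$ by $R^j_{\boldsymbol y}[f](\boldsymbol x)=f(x_1,\dots,x_{j-1},y_j,x_{j+1},\dots,x_n)$, and $\partial^j_{\boldsymbol y}:=I-R^j_{\boldsymbol y}$ with $I$ the identity operator. For $V=\{v_1,\dots,v_k\}\subseteq[n]$, $\partial^V_{\boldsymbol y}:=\partial^{v_1}_{\boldsymbol y}\cdots\partial^{v_k}_{\boldsymbol y}$ (the operators commute, so the order does not matter), and $$\Delta_V(f)=\Delta_V(f,\boldsymbol S):=\sup_{\boldsymbol x,\boldsymbol y\in\boldsymbol S}\bigl|\partial^V_{\boldsymbol y}[f](\boldsymbol x)\bigr| .$$ $\kappa_r(Z)$ is the $r$-th cumulant of a random variable $Z$, i.e. $\kappa_r(Z)=r!\,[t^r]\log\mathbf E[e^{tZ}]$, where $[t^r]$ denotes the coefficient of $t^r$ in the formal series expansion.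
   Formalization: The bound on |κ_r(f(X))| is stated for 2 ≤ r ≤ m instead of all r in [m], because at r = 1 it is false: for f = 1 and α = 0 the hypothesis holds but κ_1 = 1 > 0. *)

theory Defs
  imports
    "HOL-Probability.Probability"
    "HOL-Computational_Algebra.Formal_Power_Series"
begin

text \<open>
  Points of \<open>S\<^sub>1 \<times> \<dots> \<times> S\<^sub>n\<close> are extensional functions on the index set \<open>{1..n}\<close>, i.e. elements of
  \<open>space (PiM {1..n} S)\<close>. The operators below are defined on all functions \<open>nat \<Rightarrow> 'b\<close>; if \<open>x\<close> and
  \<open>y\<close> are in the product space and \<open>V \<subseteq> {1..n}\<close>, they evaluate \<open>f\<close> at points of that space only.
\<close>

definition repl_op :: "nat \<Rightarrow> (nat \<Rightarrow> 'b) \<Rightarrow> ((nat \<Rightarrow> 'b) \<Rightarrow> real) \<Rightarrow> (nat \<Rightarrow> 'b) \<Rightarrow> real" where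
  "repl_op j y f = (\<lambda>x. f (x(j := y j)))"

definition diff_op :: "nat \<Rightarrow> (nat \<Rightarrow> 'b) \<Rightarrow> ((nat \<Rightarrow> 'b) \<Rightarrow> real) \<Rightarrow> (nat \<Rightarrow> 'b) \<Rightarrow> real" where
  "diff_op j y f = (\<lambda>x. f x - repl_op j y f x)"

text \<open>Commutation is what makes the fold over a finite set below well defined.\<close>

lemma comp_fun_commute_diff_op: "comp_fun_commute (\<lambda>j. diff_op j y)"
proof
  fix i j :: nat
  show "diff_op i y \<circ> diff_op j y = diff_op j y \<circ> diff_op i y"
    by (cases "i = j") (auto simp: fun_eq_iff diff_op_def repl_op_def fun_upd_twist)
qed

definition diff_set :: "nat set \<Rightarrow> (nat \<Rightarrow> 'b) \<Rightarrow> ((nat \<Rightarrow> 'b) \<Rightarrow> real) \<Rightarrow> (nat \<Rightarrow> 'b) \<Rightarrow> real" where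
  "diff_set V y f = Finite_Set.fold (\<lambda>j. diff_op j y) f V"

text \<open>
  The supremum is one of real numbers: it is well defined when \<open>P\<close> is nonempty and \<open>f\<close> is bounded on \<open>P\<close>.
\<close>

definition Delta :: "(nat \<Rightarrow> 'b) set \<Rightarrow> nat set \<Rightarrow> ((nat \<Rightarrow> 'b) \<Rightarrow> real) \<Rightarrow> real" where
  "Delta P V f = (SUP (x, y) \<in> P \<times> P. \<bar>diff_set V y f x\<bar>)"

text \<open>The formal series \<open>E[exp (t Z)] = \<Sum>\<^sub>k E[Z\<^sup>k] t\<^sup>k / k!\<close> in the indeterminate \<open>t\<close>.\<close>

definition mgf_fps :: "'a measure \<Rightarrow> ('a \<Rightarrow> real) \<Rightarrow> real fps" where
  "mgf_fps M Z = Abs_fps (\<lambda>k. (LINT \<omega>|M. Z \<omega> ^ k) / fact k)"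

text \<open>
  \<^term>\<open>fps_ln 1\<close> is the series of \<open>log (1 + t)\<close>, so the composition is the formal logarithm of
  \<^term>\<open>mgf_fps M Z\<close>, whose constant term is \<open>1\<close> on a probability space.
\<close>

definition cumulant :: "'a measure \<Rightarrow> ('a \<Rightarrow> real) \<Rightarrow> nat \<Rightarrow> real" where
  "cumulant M Z r = fact r * fps_nth (fps_compose (fps_ln 1) (mgf_fps M Z - 1)) r"

text \<open>
  The first cumulant is the mean, which differences of \<open>f\<close> do not control: if \<open>f\<close> is a nonzero
  constant, then \<open>Delta P V f = 0\<close> for every nonempty \<open>V\<close>. The cumulant bound of the theorem is
  therefore stated for \<open>r \<ge> 2\<close>.
\<close>

lemma cumulant_1: "cumulant M Z 1 = (LINT \<omega>|M. Z \<omega>)"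
  by (simp add: cumulant_def mgf_fps_def fps_compose_nth fps_ln_nth)

end

theory Submission
  imports Defs
begin

text \<open>
Average the variables out one at a time. Conditionally on the coordinates after \<open>k\<close>, the formal
cumulant generating function \<open>u\<^sub>k = log E[exp (\<tau> f) | x\<^sub>k\<^sub>+\<^sub>1, \<dots>, x\<^sub>n]\<close> is a power series in a formal variable
\<open>\<tau>\<close>, with \<open>u\<^sub>0 = \<tau> f\<close>, and the coefficients of \<open>u\<^sub>n\<close> are \<open>\<kappa>\<^sub>r / r!\<close>. With a base value for
coordinate \<open>k\<close> and the increment \<open>w = u\<^sub>k\<^sub>-\<^sub>1 - u\<^sub>k\<^sub>-\<^sub>1(base)\<close> in that coordinate, the step is
\<open>u\<^sub>k = u\<^sub>k\<^sub>-\<^sub>1(base) + log E\<^sub>k[exp w] = E\<^sub>k[u\<^sub>k\<^sub>-\<^sub>1] + (log E\<^sub>k[exp w] - E\<^sub>k[w])\<close>, where the last bracket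
is of second order in the small quantity \<open>w\<close>.

The mixed differences behave like the coefficients of a multi-affine function: by the Leibniz
rule \<open>D_mult\<close>, the numbers \<open>\<Delta>\<^sub>V(F\<^sub>r) (1/4)^|V| t^r\<close>, summed over \<open>V\<close> and over the coefficient index
\<open>r\<close>, form a submultiplicative norm, and the part of the sum with \<open>j \<in> V\<close> acts as a derivation.
Only \<open>|V| + r \<le> m + 1\<close> is ever needed: a term of order \<open>r\<close> is assembled from \<open>r\<close> copies of \<open>f\<close>
linked tree-like by shared coordinates, so each copy is differenced in at most \<open>m\<close> of them. Let
\<open>B\<^sub>j(u)\<close> be the part with \<open>j \<in> V\<close>. The central estimate \<open>wnorm_ccgf\<close> is that \<open>B\<^sub>j(u\<^sub>k)\<close> does not
increase with \<open>k\<close>. Indeed, averaging over coordinate \<open>k\<close> discards from \<open>B\<^sub>j\<close> the terms with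
\<open>k \<in> V\<close>; these same terms, multiplied by \<open>4\<close> because \<open>k\<close> no longer costs a factor \<open>1/4\<close>, bound the
differences of \<open>w\<close>; and the second-order correction has at most \<open>1/4\<close> of that size
(\<open>cgf_minus_avg_bounds\<close>). The hypothesis gives \<open>B\<^sub>j(u\<^sub>0) \<le> t \<alpha> / 3 \<le> 1/48\<close> as long as \<open>t \<alpha> \<le> 1/16\<close>.

Two conclusions follow. Every step adds at most \<open>1/50 \<cdot> t^(-r)\<close> to the \<open>r\<close>-th coefficient if \<open>r \<ge> 2\<close>, so
\<open>|\<kappa>\<^sub>r| / r! \<le> (n / 50) t^(-r)\<close>. And if \<open>p\<^sub>k\<close> is \<open>u\<^sub>k\<close> cut off after order \<open>m\<close> and evaluated at
\<open>\<tau> = 1\<close>, then \<open>log E\<^sub>k[exp p\<^sub>k\<^sub>-\<^sub>1]\<close> and \<open>p\<^sub>k\<close> differ by at most \<open>t^(-(m+1))\<close> (\<open>cgf_truncation\<close>).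
The operator \<open>log E\<^sub>k[exp \<cdot>]\<close> is monotone and commutes with adding constants, so these errors just add
up, to at most \<open>n t^(-(m+1))\<close> in the exponent. It matters that the series is cut off anew at every
step. A single Taylor expansion of \<open>log E[exp (\<tau> f)]\<close> at \<open>0\<close> would need its derivative of order \<open>m + 1\<close>
at positive \<open>\<tau>\<close>, and already for \<open>m = 1\<close> small first differences do not bound that derivative linearly
in \<open>n\<close>. Finally \<open>t\<close> is \<open>1 / (16 \<alpha>)\<close>, or tends to infinity if \<open>\<alpha> = 0\<close>.
\<close>

unbundle no vec_syntax
unbundle fps_syntax

section \<open>Formal exponential and logarithm\<close>

definition fps_Exp :: "real fps \<Rightarrow> real fps" where
  "fps_Exp a = fps_exp 1 oo a"

definition fps_Ln :: "real fps \<Rightarrow> real fps" where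
  "fps_Ln a = fps_ln 1 oo (a - 1)"

lemma fps_Exp_nth_0 [simp]: "fps_Exp a $ 0 = 1"
  by (simp add: fps_Exp_def)

lemma fps_Ln_nth_0 [simp]: "fps_Ln a $ 0 = 0"
  by (simp add: fps_Ln_def)

lemma fps_deriv_Exp: "a $ 0 = 0 \<Longrightarrow> fps_deriv (fps_Exp a) = fps_Exp a * fps_deriv a"
  by (simp add: fps_Exp_def fps_compose_deriv)

lemma fps_deriv_Ln:
  assumes "a $ 0 = 1"
  shows "fps_deriv (fps_Ln a) = inverse a * fps_deriv a"
proof -
  have "inverse (1 + fps_X) oo (a - 1) = inverse (1 + fps_X oo (a - 1))"
    using assms by (subst fps_inverse_compose) (auto simp: fps_compose_add_distrib)
  also have "\<dots> = inverse a"
    using assms by (simp add: fps_X_fps_compose_startby0 fps_compose_add_distrib)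
  finally show ?thesis
    using assms by (simp add: fps_Ln_def fps_compose_deriv fps_ln_deriv)
qed

text \<open>
The identities between formal logarithms and exponentials below come from comparing formal
derivatives.
\<close>

lemma fps_eqI_deriv:
  fixes a b :: "real fps"
  assumes "fps_deriv a = fps_deriv b" "a $ 0 = b $ 0"
  shows "a = b"
  using assms by (simp add: fps_deriv_eq_iff)

lemma fps_Ln_Exp: "a $ 0 = 0 \<Longrightarrow> fps_Ln (fps_Exp a) = a"
  by (rule fps_eqI_deriv)
    (simp_all add: fps_deriv_Ln fps_deriv_Exp inverse_mult_eq_1 mult.assoc[symmetric])

lemma fps_Ln_mult:
  assumes "a $ 0 = 1" "b $ 0 = 1"
  shows "fps_Ln (a * b) = fps_Ln a + fps_Ln b"
proof (rule fps_eqI_deriv)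
  have ia: "inverse a * a = 1" and ib: "inverse b * b = 1"
    using assms by (auto simp: inverse_mult_eq_1)
  have "fps_deriv (fps_Ln (a * b)) = inverse a * inverse b * (a * fps_deriv b + fps_deriv a * b)"
    using assms by (simp add: fps_deriv_Ln fps_inverse_mult)
  also have "\<dots> = (inverse a * a) * inverse b * fps_deriv b + (inverse b * b) * inverse a * fps_deriv a"
    by (simp add: algebra_simps)
  finally show "fps_deriv (fps_Ln (a * b)) = fps_deriv (fps_Ln a + fps_Ln b)"
    using assms by (simp add: ia ib fps_deriv_Ln)
qed simp

lemma fps_Exp_Ln:
  assumes "a $ 0 = 1"
  shows "fps_Exp (fps_Ln a) = a"
proof -
  have ia: "inverse a * a = 1"
    using assms by (auto simp: inverse_mult_eq_1)
  have ia2: "inverse a * (a * x) = x" for x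
    using ia by (simp add: mult.assoc[symmetric])
  have "fps_Exp (fps_Ln a) * inverse a = 1"
  proof (rule fps_eqI_deriv)
    have "fps_deriv (inverse a) = - fps_deriv a * inverse a ^ 2"
      using assms by (simp add: fps_inverse_deriv)
    then show "fps_deriv (fps_Exp (fps_Ln a) * inverse a) = fps_deriv 1"
      using assms by (simp add: fps_deriv_Exp fps_deriv_Ln power2_eq_square algebra_simps)
  qed (use assms in simp)
  then have "fps_Exp (fps_Ln a) * (inverse a * a) = a"
    by (metis mult.assoc mult_1_left)
  then show ?thesis by (simp add: ia)
qed

lemma fps_Exp_add:
  assumes "a $ 0 = 0" "b $ 0 = 0"
  shows "fps_Exp (a + b) = fps_Exp a * fps_Exp b"
proof -
  have "fps_Ln (fps_Exp a * fps_Exp b) = a + b"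
    using assms by (simp add: fps_Ln_mult fps_Ln_Exp)
  then show ?thesis
    by (metis fps_Exp_Ln fps_Exp_nth_0 fps_mult_nth_0 mult_1_left)
qed

lemma fps_exp_eq_Exp: "fps_exp c = fps_Exp (fps_const c * fps_X)"
  by (simp add: fps_Exp_def)

section \<open>Iterated differences and averages on a product space\<close>

lemma diff_set_empty [simp]: "diff_set {} y f = f"
  by (simp add: diff_set_def)

lemma diff_set_insert:
  assumes "finite V" "j \<notin> V"
  shows "diff_set (insert j V) y f = diff_op j y (diff_set V y f)"
proof -
  interpret comp_fun_commute "\<lambda>j. diff_op j y"
    by (rule comp_fun_commute_diff_op)
  show ?thesis
    using assms by (simp add: diff_set_def fold_insert)
qed

lemma diff_set_insert2:
  assumes "finite V" "j \<notin> V"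
  shows "diff_set (insert j V) y f = diff_set V y (diff_op j y f)"
proof -
  interpret comp_fun_commute "\<lambda>j. diff_op j y"
    by (rule comp_fun_commute_diff_op)
  show ?thesis
    using assms unfolding diff_set_def by (rule fold_insert2)
qed

lemma diff_set_add:
  "finite V \<Longrightarrow> diff_set V y (\<lambda>x. f x + g x) = (\<lambda>x. diff_set V y f x + diff_set V y g x)"
  by (induction V rule: finite_induct)
    (auto simp: diff_set_insert diff_op_def repl_op_def fun_eq_iff)

lemma diff_set_cmult:
  "finite V \<Longrightarrow> diff_set V y (\<lambda>x. c * f x) = (\<lambda>x. c * diff_set V y f x)"
  by (induction V rule: finite_induct)
    (auto simp: diff_set_insert diff_op_def repl_op_def fun_eq_iff algebra_simps)

text \<open>
The difference over \<open>V\<close> reads only the coordinates of \<open>y\<close> in \<open>V\<close>. This lets two differences that are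
taken with different points \<open>y\<close> and disjoint sets of coordinates be merged into one.
\<close>

lemma diff_set_update_irrelevant:
  "finite V \<Longrightarrow> k \<notin> V \<Longrightarrow> diff_set V (y(k := s)) f = diff_set V y f"
  by (induction V rule: finite_induct)
    (auto simp: diff_set_insert diff_op_def repl_op_def fun_eq_iff)

lemma diff_set_repl:
  assumes "finite V" "k \<notin> V"
  shows "diff_set V y' (repl_op k y f) x = diff_set V y' f (x(k := y k))"
  using assms
  by (induction V arbitrary: x rule: finite_induct)
    (auto simp: diff_set_insert diff_op_def repl_op_def fun_upd_twist)

locale product_law = finite_product_prob_space \<mu> I
  for \<mu> :: "nat \<Rightarrow> 'b measure" and I :: "nat set"
begin

abbreviation P :: "(nat \<Rightarrow> 'b) set" where
  "P \<equiv> space (PiM I \<mu>)"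

abbreviation D :: "nat set \<Rightarrow> ((nat \<Rightarrow> 'b) \<Rightarrow> real) \<Rightarrow> real" where
  "D \<equiv> Delta P"

text \<open>
The supremum \<open>Delta\<close> is meaningful for bounded functions, and averages over a coordinate require
measurability; both properties pass to all functions built from \<open>f\<close>.
\<close>

definition bmeas :: "((nat \<Rightarrow> 'b) \<Rightarrow> real) \<Rightarrow> bool" where
  "bmeas f \<longleftrightarrow> f \<in> borel_measurable (PiM I \<mu>) \<and> bounded (f ` P)"

definition avg :: "nat \<Rightarrow> ((nat \<Rightarrow> 'b) \<Rightarrow> real) \<Rightarrow> (nat \<Rightarrow> 'b) \<Rightarrow> real" where
  "avg k f x = (LINT s|\<mu> k. f (x(k := s)))"

lemma P_nonempty: "P \<noteq> {}"
  by (rule not_empty)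

lemma finI [simp]: "finite I"
  by (rule finite_index)

lemma upd_in_P: "x \<in> P \<Longrightarrow> k \<in> I \<Longrightarrow> s \<in> space (\<mu> k) \<Longrightarrow> x(k := s) \<in> P"
  by (auto simp: space_PiM PiE_def extensional_def Pi_def)

lemma coord_in: "y \<in> P \<Longrightarrow> k \<in> I \<Longrightarrow> y k \<in> space (\<mu> k)"
  by (auto simp: space_PiM PiE_def)

lemma upd_P [simp]: "x \<in> P \<Longrightarrow> y \<in> P \<Longrightarrow> k \<in> I \<Longrightarrow> x(k := y k) \<in> P"
  by (intro upd_in_P coord_in)

lemma bmeas_bound: "bmeas f \<Longrightarrow> \<exists>C. \<forall>x\<in>P. \<bar>f x\<bar> \<le> C"
  by (auto simp: bmeas_def bounded_iff)

lemma bmeasI: "f \<in> borel_measurable (PiM I \<mu>) \<Longrightarrow> (\<And>x. x \<in> P \<Longrightarrow> \<bar>f x\<bar> \<le> C) \<Longrightarrow> bmeas f"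
  by (auto simp: bmeas_def bounded_iff)

lemma bmeas_measurable: "bmeas f \<Longrightarrow> f \<in> borel_measurable (PiM I \<mu>)"
  by (simp add: bmeas_def)

lemma bmeas_const [simp]: "bmeas (\<lambda>x. c)"
  by (rule bmeasI) auto

lemma bmeas_add: 
  assumes "bmeas f" "bmeas g" shows "bmeas (\<lambda>x. f x + g x)"
proof -
  obtain A B where "\<forall>x\<in>P. \<bar>f x\<bar> \<le> A" "\<forall>x\<in>P. \<bar>g x\<bar> \<le> B"
    using assms bmeas_bound by metis
  then show ?thesis
    using assms by (intro bmeasI[where C = "A + B"] borel_measurable_add) (auto simp: bmeas_measurable intro: abs_triangle_ineq[THEN order_trans] add_mono)
qed

lemma bmeas_mult: 
  assumes "bmeas f" "bmeas g" shows "bmeas (\<lambda>x. f x * g x)"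
proof -
  obtain A B where "\<forall>x\<in>P. \<bar>f x\<bar> \<le> A" "\<forall>x\<in>P. \<bar>g x\<bar> \<le> B"
    using assms bmeas_bound by metis
  then have "\<bar>f x * g x\<bar> \<le> A * B" if "x \<in> P" for x
    using that unfolding abs_mult by (intro mult_mono') auto
  then show ?thesis
    using assms by (intro bmeasI[where C = "A * B"] borel_measurable_times) (auto simp: bmeas_measurable)
qed

lemma bmeas_diff: "bmeas f \<Longrightarrow> bmeas g \<Longrightarrow> bmeas (\<lambda>x. f x - g x)"
  using bmeas_add[of f "\<lambda>x. (-1) * g x"] bmeas_mult[of "\<lambda>_. -1" g] by simp

lemma bmeas_sum: "(\<And>i. i \<in> A \<Longrightarrow> bmeas (f i)) \<Longrightarrow> bmeas (\<lambda>x. \<Sum>i\<in>A. f i x)"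
  by (induction A rule: infinite_finite_induct) (auto intro: bmeas_add)

lemma bmeas_power: "bmeas f \<Longrightarrow> bmeas (\<lambda>x. f x ^ i)"
  by (induction i) (auto intro: bmeas_mult)

lemma bmeas_exp:
  assumes "bmeas f" shows "bmeas (\<lambda>x. exp (f x))"
proof -
  obtain A where "\<forall>x\<in>P. \<bar>f x\<bar> \<le> A"
    using assms bmeas_bound by metis
  then show ?thesis
    using assms by (intro bmeasI[where C = "exp A"] measurable_compose[OF _ borel_measurable_exp]) (auto simp: bmeas_measurable)
qed

lemma bmeas_repl:
  assumes "bmeas f" "y \<in> P" "k \<in> I" shows "bmeas (repl_op k y f)"
proof -
  obtain A where A: "\<forall>x\<in>P. \<bar>f x\<bar> \<le> A"
    using assms bmeas_bound by metis
  have [measurable]: "(\<lambda>x. x(k := y k)) \<in> PiM I \<mu> \<rightarrow>\<^sub>M PiM I \<mu>"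
    using assms coord_in by (intro measurable_fun_upd[where J = I]) auto
  have [measurable]: "f \<in> borel_measurable (PiM I \<mu>)"
    using assms bmeas_measurable by blast
  show ?thesis
    unfolding repl_op_def using A assms by (intro bmeasI[of _ A]) auto
qed

lemma bmeas_diff_op: "bmeas f \<Longrightarrow> y \<in> P \<Longrightarrow> k \<in> I \<Longrightarrow> bmeas (diff_op k y f)"
  unfolding diff_op_def by (intro bmeas_diff bmeas_repl)

lemma bmeas_diff_set:
  assumes "V \<subseteq> I" "bmeas f" "y \<in> P" shows "bmeas (diff_set V y f)"
proof -
  have "finite V" using assms finI finite_subset by blast
  then show ?thesis
    using assms by (induction V rule: finite_induct) (auto simp: diff_set_insert bmeas_diff_op)
qed

lemma integrable_section:
  assumes "bmeas f" "x \<in> P" "k \<in> I"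
  shows "integrable (\<mu> k) (\<lambda>s. f (x(k := s)))"
proof -
  obtain A where A: "\<forall>x\<in>P. \<bar>f x\<bar> \<le> A"
    using assms bmeas_bound by metis
  have [measurable]: "(\<lambda>s. x(k := s)) \<in> \<mu> k \<rightarrow>\<^sub>M PiM I \<mu>"
    using assms by (intro measurable_fun_upd[where J = I]) auto
  have [measurable]: "f \<in> borel_measurable (PiM I \<mu>)"
    using assms bmeas_measurable by blast
  show ?thesis
    using A assms upd_in_P by (intro M.integrable_const_bound[of _ A]) auto
qed

lemma avg_add:
  assumes "bmeas f" "bmeas g" "x \<in> P" "k \<in> I"
  shows "avg k (\<lambda>x. f x + g x) x = avg k f x + avg k g x"
  unfolding avg_def using assms by (intro Bochner_Integration.integral_add integrable_section)

lemma avg_diff: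
  assumes "bmeas f" "bmeas g" "x \<in> P" "k \<in> I"
  shows "avg k (\<lambda>x. f x - g x) x = avg k f x - avg k g x"
  unfolding avg_def using assms by (intro Bochner_Integration.integral_diff integrable_section)

lemma avg_sum:
  assumes "\<And>i. i \<in> A \<Longrightarrow> bmeas (f i)" "x \<in> P" "k \<in> I"
  shows "avg k (\<lambda>x. \<Sum>i\<in>A. f i x) x = (\<Sum>i\<in>A. avg k (f i) x)"
  unfolding avg_def using assms by (intro Bochner_Integration.integral_sum integrable_section)

lemma avg_const [simp]: "avg k (\<lambda>x. c) x = c"
proof -
  show ?thesis by (simp add: avg_def M.prob_space)
qed

lemma avg_mono:
  assumes "bmeas f" "bmeas g" "x \<in> P" "k \<in> I" "\<And>z. z \<in> P \<Longrightarrow> f z \<le> g z"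
  shows "avg k f x \<le> avg k g x"
  unfolding avg_def using assms upd_in_P by (intro integral_mono integrable_section) auto

lemma avg_cong:
  assumes "x \<in> P" "k \<in> I" "\<And>z. z \<in> P \<Longrightarrow> f z = g z"
  shows "avg k f x = avg k g x"
  unfolding avg_def using assms upd_in_P by (intro Bochner_Integration.integral_cong) auto

lemma abs_avg_le:
  assumes "bmeas f" "x \<in> P" "k \<in> I" "\<And>z. z \<in> P \<Longrightarrow> \<bar>f z\<bar> \<le> c"
  shows "\<bar>avg k f x\<bar> \<le> c"
proof -
  have "avg k f x \<le> avg k (\<lambda>_. c) x" "avg k (\<lambda>_. - c) x \<le> avg k f x"
    using assms by (intro avg_mono; force)+
  then show ?thesis by simp
qed

lemma bmeas_avg:
  assumes "bmeas f" "k \<in> I" shows "bmeas (avg k f)"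
proof -
  obtain A where A: "\<forall>x\<in>P. \<bar>f x\<bar> \<le> A"
    using assms bmeas_bound by metis
  have [measurable]: "(\<lambda>(x, s). x(k := s)) \<in> PiM I \<mu> \<Otimes>\<^sub>M \<mu> k \<rightarrow>\<^sub>M PiM I \<mu>"
    unfolding case_prod_beta using assms by (intro measurable_fun_upd[where J = I]) auto
  have fm[measurable]: "f \<in> borel_measurable (PiM I \<mu>)"
    using assms bmeas_measurable by blast
  have [measurable]: "avg k f \<in> borel_measurable (PiM I \<mu>)"
    unfolding avg_def by measurable
  show ?thesis
    using A assms by (intro bmeasI[of _ A] abs_avg_le) auto
qed

lemma diff_set_cong:
  assumes "V \<subseteq> I" "x \<in> P" "y \<in> P" "\<And>z. z \<in> P \<Longrightarrow> f z = g z"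
  shows "diff_set V y f x = diff_set V y g x"
proof -
  have "finite V" using assms finI finite_subset by blast
  then show ?thesis
    using assms(1-3)
    by (induction V arbitrary: x rule: finite_induct)
      (auto simp: diff_set_insert diff_op_def repl_op_def assms)
qed

text \<open>
Averaging over a coordinate commutes with differences in the other coordinates, so it does not
increase \<open>Delta\<close> (\<open>D_avg\<close> below).
\<close>

lemma diff_set_avg:
  assumes "bmeas f" "V \<subseteq> I" "k \<in> I" "k \<notin> V" "x \<in> P" "y \<in> P"
  shows "diff_set V y (avg k f) x = avg k (diff_set V y f) x"
proof -
  have "finite V" using assms finI finite_subset by blast
  then show ?thesis
    using assms(2,4,5)
  proof (induction V arbitrary: x rule: finite_induct)
    case (insert j V)
    let ?h = "diff_set V y f"
    have h: "bmeas ?h" using insert.prems assms by (intro bmeas_diff_set) auto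
    have jk: "j \<noteq> k" using insert by auto
    have "diff_set (insert j V) y (avg k f) x = avg k ?h x - avg k ?h (x(j := y j))"
      using insert assms by (simp add: diff_set_insert diff_op_def repl_op_def)
    also have "avg k ?h (x(j := y j)) = avg k (repl_op j y ?h) x"
      using jk by (simp add: avg_def repl_op_def fun_upd_twist)
    also have "avg k ?h x - avg k (repl_op j y ?h) x = avg k (diff_op j y ?h) x"
      unfolding diff_op_def using insert.prems assms h
      by (intro avg_diff[symmetric] bmeas_repl) auto
    finally show ?case using insert by (simp add: diff_set_insert)
  qed simp
qed

lemma D_le:
  assumes "\<And>x y. x \<in> P \<Longrightarrow> y \<in> P \<Longrightarrow> \<bar>diff_set V y f x\<bar> \<le> c"
  shows "D V f \<le> c"
  unfolding Delta_def using P_nonempty assms by (intro cSUP_least) auto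

lemma abs_diff_set_le_power:
  assumes "V \<subseteq> I" "x \<in> P" "y \<in> P" "\<And>z. z \<in> P \<Longrightarrow> \<bar>f z\<bar> \<le> C"
  shows "\<bar>diff_set V y f x\<bar> \<le> 2 ^ card V * C"
proof -
  have "finite V" using assms finI finite_subset by blast
  then show ?thesis
    using assms(1-3)
  proof (induction V arbitrary: x rule: finite_induct)
    case (insert j V)
    have "x(j := y j) \<in> P" "V \<subseteq> I"
      using upd_P insert.prems by auto
    then have "\<bar>diff_set V y f x\<bar> \<le> 2 ^ card V * C" "\<bar>diff_set V y f (x(j := y j))\<bar> \<le> 2 ^ card V * C"
      using insert by blast+
    then have "\<bar>diff_set V y f x - diff_set V y f (x(j := y j))\<bar> \<le> 2 * (2 ^ card V * C)"
      by linarith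
    then show ?case using insert.hyps by (simp add: diff_set_insert diff_op_def repl_op_def mult.assoc)
  qed (auto simp: assms)
qed

lemma abs_diff_set_le_D:
  assumes "bmeas f" "V \<subseteq> I" "x \<in> P" "y \<in> P"
  shows "\<bar>diff_set V y f x\<bar> \<le> D V f"
proof -
  obtain C where C: "\<forall>x\<in>P. \<bar>f x\<bar> \<le> C"
    using assms bmeas_bound by metis
  have "bdd_above ((\<lambda>(x, y). \<bar>diff_set V y f x\<bar>) ` (P \<times> P))"
    using abs_diff_set_le_power[of V _ _ f C] C assms
    by (intro bdd_aboveI2[of _ _ "2 ^ card V * C"]) auto
  then show ?thesis
    unfolding Delta_def using cSUP_upper[of "(x, y)" "P \<times> P" "\<lambda>(x, y). \<bar>diff_set V y f x\<bar>"] assms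
    by auto
qed

lemma D_nonneg: "bmeas f \<Longrightarrow> V \<subseteq> I \<Longrightarrow> 0 \<le> D V f"
  using abs_diff_set_le_D[of f V] P_nonempty by fastforce

lemma D_cong: "V \<subseteq> I \<Longrightarrow> (\<And>z. z \<in> P \<Longrightarrow> f z = g z) \<Longrightarrow> D V f = D V g"
  unfolding Delta_def by (intro SUP_cong) (auto simp: diff_set_cong[of V _ _ f g])

lemma abs_le_D_empty: "bmeas f \<Longrightarrow> x \<in> P \<Longrightarrow> \<bar>f x\<bar> \<le> D {} f"
  using abs_diff_set_le_D[of f "{}" x x] by simp

lemma D_add:
  assumes "bmeas f" "bmeas g" "V \<subseteq> I"
  shows "D V (\<lambda>x. f x + g x) \<le> D V f + D V g"
proof (rule D_le)
  fix x y assume "x \<in> P" "y \<in> P"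
  then have "\<bar>diff_set V y f x\<bar> \<le> D V f" "\<bar>diff_set V y g x\<bar> \<le> D V g"
    using assms by (auto intro: abs_diff_set_le_D)
  moreover have "finite V" using assms finI finite_subset by blast
  ultimately show "\<bar>diff_set V y (\<lambda>x. f x + g x) x\<bar> \<le> D V f + D V g"
    by (simp add: diff_set_add)
qed

lemma D_cmult:
  assumes "bmeas f" "V \<subseteq> I"
  shows "D V (\<lambda>x. c * f x) \<le> \<bar>c\<bar> * D V f"
proof (rule D_le)
  fix x y assume "x \<in> P" "y \<in> P"
  then have "\<bar>diff_set V y f x\<bar> \<le> D V f"
    using assms by (auto intro: abs_diff_set_le_D)
  moreover have "finite V" using assms finI finite_subset by blast
  ultimately show "\<bar>diff_set V y (\<lambda>x. c * f x) x\<bar> \<le> \<bar>c\<bar> * D V f"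
    by (simp add: diff_set_cmult abs_mult mult_left_mono)
qed

lemma D_zero [simp]: "V \<subseteq> I \<Longrightarrow> D V (\<lambda>x. 0) = 0"
  using D_cmult[of "\<lambda>_. 0" V 0] D_nonneg[of "\<lambda>_. 0" V] by simp

lemma D_sum:
  assumes "\<And>i. i \<in> A \<Longrightarrow> bmeas (f i)" "V \<subseteq> I"
  shows "D V (\<lambda>x. \<Sum>i\<in>A. f i x) \<le> (\<Sum>i\<in>A. D V (f i))"
  using assms(1)
proof (induction A rule: infinite_finite_induct)
  case (insert i A)
  have "D V (\<lambda>x. f i x + (\<Sum>i\<in>A. f i x)) \<le> D V (f i) + D V (\<lambda>x. \<Sum>i\<in>A. f i x)"
    using insert assms by (intro D_add bmeas_sum) auto
  also have "D V (\<lambda>x. \<Sum>i\<in>A. f i x) \<le> (\<Sum>i\<in>A. D V (f i))"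
    using insert by auto
  finally show ?case using insert by simp
qed (use assms in auto)

lemma D_repl:
  assumes "bmeas f" "V \<subseteq> I" "k \<in> I" "k \<notin> V" "y \<in> P"
  shows "D V (repl_op k y f) \<le> D V f"
proof (rule D_le)
  fix x y' assume "x \<in> P" "y' \<in> P"
  moreover have "finite V" using assms finI finite_subset by blast
  ultimately show "\<bar>diff_set V y' (repl_op k y f) x\<bar> \<le> D V f"
    using assms by (simp add: diff_set_repl abs_diff_set_le_D)
qed

text \<open>
The base value \<open>y k\<close> of the inner difference is fixed and the outer supremum runs over a different
point \<open>y'\<close>. Since \<open>k \<notin> V\<close>, both can be read off the single point \<open>y'(k := y k)\<close>.
\<close>

lemma D_diff_op:
  assumes "bmeas f" "V \<subseteq> I" "k \<in> I" "k \<notin> V" "y \<in> P"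
  shows "D V (diff_op k y f) \<le> D (insert k V) f"
proof (rule D_le)
  fix x y' assume xy: "x \<in> P" "y' \<in> P"
  have finV: "finite V" using assms finI finite_subset by blast
  have op: "diff_op k y f = diff_op k (y'(k := y k)) f"
    by (simp add: diff_op_def repl_op_def)
  have "diff_set V y' (diff_op k y f) = diff_set V (y'(k := y k)) (diff_op k y f)"
    using finV assms by (simp add: diff_set_update_irrelevant)
  also have "\<dots> = diff_set (insert k V) (y'(k := y k)) f"
    using finV assms unfolding op by (simp add: diff_set_insert2)
  finally show "\<bar>diff_set V y' (diff_op k y f) x\<bar> \<le> D (insert k V) f"
    using assms xy by (auto intro!: abs_diff_set_le_D)
qed

lemma D_avg:
  assumes "bmeas f" "V \<subseteq> I" "k \<in> I" "k \<notin> V"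
  shows "D V (avg k f) \<le> D V f"
  using assms
  by (intro D_le) (auto simp: diff_set_avg intro!: abs_avg_le bmeas_diff_set abs_diff_set_le_D)

lemma sum_Pow_insert:
  fixes h :: "nat set \<Rightarrow> real"
  assumes "finite V" "j \<notin> V"
  shows "(\<Sum>W\<in>Pow (insert j V). h W) = (\<Sum>W\<in>Pow V. h W) + (\<Sum>W\<in>Pow V. h (insert j W))"
proof -
  have "inj_on (insert j) (Pow V)"
    using assms by (intro inj_onI) (metis PowD insert_ident subsetD)
  moreover have "Pow V \<inter> insert j ` Pow V = {}"
    using assms by auto
  ultimately show ?thesis
    using assms by (simp add: Pow_insert sum.union_disjoint sum.reindex)
qed

text \<open>
Leibniz rule. One difference of a product is \<open>\<partial>(f g) = \<partial>f \<cdot> g + Rf \<cdot> \<partial>g\<close>, with \<open>R\<close> the replacement of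
the coordinate, and the replacement in the second term does not increase suprema. Iterating over \<open>V\<close>
assigns every coordinate to one of the two factors.
\<close>

lemma abs_diff_set_mult_le:
  assumes "V \<subseteq> I" "bmeas f" "bmeas g" "x \<in> P" "y \<in> P"
  shows "\<bar>diff_set V y (\<lambda>x. f x * g x) x\<bar> \<le> (\<Sum>W\<in>Pow V. D W f * D (V - W) g)"
proof -
  have "finite V" using assms finI finite_subset by blast
  then show ?thesis
    using assms(1-3)
  proof (induction V arbitrary: f g rule: finite_induct)
    case empty
    then show ?case
      using assms by (auto simp: abs_mult intro!: mult_mono abs_le_D_empty D_nonneg)
  next
    case (insert j V)
    let ?d = "diff_op j y" and ?r = "repl_op j y"
    have j: "j \<in> I" "V \<subseteq> I" using insert by auto
    have bms: "bmeas (?d f)" "bmeas (?d g)" "bmeas (?r f)" "bmeas g"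
      using insert assms j by (auto intro: bmeas_diff_op bmeas_repl)
    have sub: "W \<subseteq> I" "j \<notin> W" if "W \<in> Pow V" for W using that insert by auto
    have 1: "?d (\<lambda>x. f x * g x) = (\<lambda>x. ?d f x * g x + ?r f x * ?d g x)"
      by (auto simp: diff_op_def repl_op_def fun_eq_iff algebra_simps)
    have "\<bar>diff_set (insert j V) y (\<lambda>x. f x * g x) x\<bar>
        = \<bar>diff_set V y (\<lambda>x. ?d f x * g x) x + diff_set V y (\<lambda>x. ?r f x * ?d g x) x\<bar>"
      using insert by (simp add: diff_set_insert2 1 diff_set_add)
    also have "\<dots> \<le> (\<Sum>W\<in>Pow V. D W (?d f) * D (V - W) g) + (\<Sum>W\<in>Pow V. D W (?r f) * D (V - W) (?d g))"
      using insert.IH[of "?d f" g] insert.IH[of "?r f" "?d g"] bms j by linarith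
    also have "\<dots> \<le> (\<Sum>W\<in>Pow V. D (insert j W) f * D (V - W) g)
        + (\<Sum>W\<in>Pow V. D W f * D (insert j (V - W)) g)"
    proof (intro add_mono sum_mono mult_mono)
      fix W assume W: "W \<in> Pow V"
      note s = sub[OF W] sub[of "V - W"]
      show "D W (?d f) \<le> D (insert j W) f" "D W (?r f) \<le> D W f"
        using s insert.prems j assms by (auto intro: D_diff_op D_repl)
      show "D (V - W) (?d g) \<le> D (insert j (V - W)) g"
        using s insert.prems j assms by (intro D_diff_op) auto
      show "0 \<le> D (insert j W) f" "0 \<le> D (V - W) g" "0 \<le> D W f" "0 \<le> D (V - W) (?d g)"
        using s insert.prems j bms by (auto intro!: D_nonneg)
    qed simp
    also have "\<dots> = (\<Sum>W\<in>Pow (insert j V). D W f * D (insert j V - W) g)"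
    proof -
      have "(\<Sum>W\<in>Pow V. D (insert j W) f * D (V - W) g) 
          = (\<Sum>W\<in>Pow V. D (insert j W) f * D (insert j V - insert j W) g)"
        using insert.hyps by (intro sum.cong refl) simp
      moreover have "(\<Sum>W\<in>Pow V. D W f * D (insert j (V - W)) g)
          = (\<Sum>W\<in>Pow V. D W f * D (insert j V - W) g)"
        using insert.hyps by (intro sum.cong refl arg_cong2[where f = "(*)"] arg_cong2[where f = "D"]) auto
      ultimately show ?thesis using insert.hyps by (simp add: sum_Pow_insert)
    qed
    finally show ?case .
  qed
qed

lemma D_mult:
  assumes "bmeas f" "bmeas g" "V \<subseteq> I"
  shows "D V (\<lambda>x. f x * g x) \<le> (\<Sum>W\<in>Pow V. D W f * D (V - W) g)"
  using assms by (intro D_le abs_diff_set_mult_le)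

end

section \<open>Truncated weighted norms\<close>

context product_law
begin

text \<open>
From here on functions take values in formal power series in \<open>\<tau>\<close>, and all notions are applied to each
coefficient separately.
\<close>

definition bmeasF :: "((nat \<Rightarrow> 'b) \<Rightarrow> real fps) \<Rightarrow> bool" where
  "bmeasF F \<longleftrightarrow> (\<forall>r. bmeas (\<lambda>x. F x $ r))"

definition avgF :: "nat \<Rightarrow> ((nat \<Rightarrow> 'b) \<Rightarrow> real fps) \<Rightarrow> (nat \<Rightarrow> 'b) \<Rightarrow> real fps" where
  "avgF k F x = Abs_fps (\<lambda>r. avg k (\<lambda>x. F x $ r) x)"

lemma avgF_nth [simp]: "avgF k F x $ r = avg k (\<lambda>x. F x $ r) x"
  by (simp add: avgF_def)

lemma bmeasF_nth: "bmeasF F \<Longrightarrow> bmeas (\<lambda>x. F x $ r)"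
  by (simp add: bmeasF_def)

lemma bmeasF_const [simp]: "bmeasF (\<lambda>x. c)"
  by (simp add: bmeasF_def)

lemma bmeasF_diff: "bmeasF F \<Longrightarrow> bmeasF G \<Longrightarrow> bmeasF (\<lambda>x. F x - G x)"
  by (simp add: bmeasF_def bmeas_diff)

lemma bmeasF_mult: "bmeasF F \<Longrightarrow> bmeasF G \<Longrightarrow> bmeasF (\<lambda>x. F x * G x)"
  by (simp add: bmeasF_def fps_mult_nth bmeas_sum bmeas_mult)

lemma bmeasF_power: "bmeasF F \<Longrightarrow> bmeasF (\<lambda>x. F x ^ i)"
  by (induction i) (auto intro: bmeasF_mult)

lemma bmeasF_compose: "bmeasF F \<Longrightarrow> bmeasF (\<lambda>x. c oo F x)"
  using bmeasF_power[of F] by (auto simp: bmeasF_def fps_compose_nth intro!: bmeas_sum bmeas_mult)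

lemma bmeasF_avgF: "bmeasF F \<Longrightarrow> k \<in> I \<Longrightarrow> bmeasF (avgF k F)"
  by (simp add: bmeasF_def bmeas_avg)

lemma bmeasF_repl: "bmeasF F \<Longrightarrow> y \<in> P \<Longrightarrow> k \<in> I \<Longrightarrow> bmeasF (\<lambda>x. F (x(k := y k)))"
  using bmeas_repl by (auto simp: bmeasF_def repl_op_def)

end

text \<open>
A pair \<open>(V, r)\<close> stands for the difference over \<open>V\<close> of the coefficient of \<open>\<tau>^r\<close>. Leaving out \<open>r = 0\<close>
means that the norm is used for series without constant term; these gain one order in every
product, which is the source of the shift from \<open>L\<close> to \<open>Suc L\<close> in \<open>trunc_idx_split\<close> and in the product rules.
\<close>

definition trunc_idx :: "nat set \<Rightarrow> nat \<Rightarrow> (nat set \<times> nat) set" where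
  "trunc_idx J L = {(V, r). V \<subseteq> J \<and> 1 \<le> r \<and> card V + r \<le> L}"

definition trunc_idx_at :: "nat set \<Rightarrow> nat \<Rightarrow> nat \<Rightarrow> (nat set \<times> nat) set" where
  "trunc_idx_at J L j = {p \<in> trunc_idx J L. j \<in> fst p}"

lemma trunc_idx_subset: "trunc_idx J L \<subseteq> Pow J \<times> {1..L}"
  by (auto simp: trunc_idx_def)

lemma trunc_idx_at_subset: "trunc_idx_at J L j \<subseteq> trunc_idx J L"
  by (auto simp: trunc_idx_at_def)

lemma finite_trunc_idx: "finite J \<Longrightarrow> finite (trunc_idx J L)"
  by (rule finite_subset[OF trunc_idx_subset]) auto

lemma finite_trunc_idx_at: "finite J \<Longrightarrow> finite (trunc_idx_at J L j)"
  by (rule finite_subset[OF trunc_idx_at_subset finite_trunc_idx])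

lemma trunc_idx_mono: "L \<le> L' \<Longrightarrow> trunc_idx J L \<subseteq> trunc_idx J L'"
  by (auto simp: trunc_idx_def)

lemma trunc_idx_at_mono: "L \<le> L' \<Longrightarrow> trunc_idx_at J L j \<subseteq> trunc_idx_at J L' j"
  by (auto simp: trunc_idx_def trunc_idx_at_def)

locale weighted_product_law = product_law \<mu> I for \<mu> :: "nat \<Rightarrow> 'b measure" and I +
  fixes t :: real
  assumes t_pos: "t > 0"
begin

text \<open>
The weight is multiplicative under disjoint union of the sets and addition of the orders, as the
product rules require. The constant \<open>1/4\<close> balances two demands: it must make the geometric series
over \<open>|V|\<close> small, and its inverse must not outweigh the gain in \<open>cgf_minus_avg_bounds\<close>.
\<close>

definition wt :: "((nat \<Rightarrow> 'b) \<Rightarrow> real fps) \<Rightarrow> nat set \<times> nat \<Rightarrow> real" where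
  "wt F p = D (fst p) (\<lambda>x. F x $ snd p) * (1/4) ^ card (fst p) * t ^ snd p"

definition wnorm :: "(nat set \<times> nat) set \<Rightarrow> ((nat \<Rightarrow> 'b) \<Rightarrow> real fps) \<Rightarrow> real" where
  "wnorm Q F = (\<Sum>p\<in>Q. wt F p)"

lemma wt_nonneg: "bmeasF F \<Longrightarrow> fst p \<subseteq> I \<Longrightarrow> 0 \<le> wt F p"
  using t_pos by (auto simp: wt_def bmeasF_nth D_nonneg)

lemma wnorm_nonneg: "bmeasF F \<Longrightarrow> \<forall>p\<in>Q. fst p \<subseteq> I \<Longrightarrow> 0 \<le> wnorm Q F"
  unfolding wnorm_def by (intro sum_nonneg wt_nonneg) auto

lemma wnorm_mono_set:
  "bmeasF F \<Longrightarrow> \<forall>p\<in>Q'. fst p \<subseteq> I \<Longrightarrow> finite Q' \<Longrightarrow> Q \<subseteq> Q' \<Longrightarrow> wnorm Q F \<le> wnorm Q' F"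
  unfolding wnorm_def by (intro sum_mono2 wt_nonneg) auto

lemma wt_mono:
  assumes "D (fst p) (\<lambda>x. F x $ snd p) \<le> D (fst p) (\<lambda>x. G x $ snd p)"
  shows "wt F p \<le> wt G p"
  unfolding wt_def using assms t_pos by (intro mult_right_mono) auto

lemma wt_cong:
  assumes "fst p \<subseteq> I" "\<And>x. x \<in> P \<Longrightarrow> F x = G x"
  shows "wt F p = wt G p"
  using D_cong[of "fst p" "\<lambda>x. F x $ snd p" "\<lambda>x. G x $ snd p"] assms by (simp add: wt_def)

lemma wnorm_cong:
  assumes "\<forall>p\<in>Q. fst p \<subseteq> I" "\<And>x. x \<in> P \<Longrightarrow> F x = G x"
  shows "wnorm Q F = wnorm Q G"
  unfolding wnorm_def using assms by (intro sum.cong wt_cong) auto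

lemma wt_add:
  assumes "bmeasF F" "bmeasF G" "fst p \<subseteq> I"
  shows "wt (\<lambda>x. F x + G x) p \<le> wt F p + wt G p"
proof -
  have "D (fst p) (\<lambda>x. (F x + G x) $ snd p)
      \<le> D (fst p) (\<lambda>x. F x $ snd p) + D (fst p) (\<lambda>x. G x $ snd p)"
    using assms by (simp add: D_add bmeasF_nth)
  from mult_right_mono[OF this, of "(1/4) ^ card (fst p) * t ^ snd p"] show ?thesis
    using t_pos by (simp add: wt_def algebra_simps)
qed

lemma wnorm_add:
  assumes "bmeasF F" "bmeasF G" "\<forall>p\<in>Q. fst p \<subseteq> I"
  shows "wnorm Q (\<lambda>x. F x + G x) \<le> wnorm Q F + wnorm Q G"
  unfolding wnorm_def sum.distrib[symmetric] using assms by (intro sum_mono wt_add) auto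

lemma wnorm_avgF:
  assumes "bmeasF F" "k \<in> I" "\<forall>p\<in>Q. fst p \<subseteq> I - {k}"
  shows "wnorm Q (avgF k F) \<le> wnorm Q F"
  unfolding wnorm_def
proof (intro sum_mono wt_mono)
  fix p assume "p \<in> Q"
  then have "fst p \<subseteq> I" "k \<notin> fst p" using assms by auto
  then show "D (fst p) (\<lambda>x. avgF k F x $ snd p) \<le> D (fst p) (\<lambda>x. F x $ snd p)"
    using D_avg[of "\<lambda>x. F x $ snd p" "fst p" k] assms by (simp add: bmeasF_nth)
qed

lemma wt_mult:
  assumes "bmeasF F" "bmeasF G" "V \<subseteq> I"
    and F0: "\<And>x. x \<in> P \<Longrightarrow> F x $ 0 = 0" and G0: "\<And>x. x \<in> P \<Longrightarrow> G x $ 0 = 0"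
  shows "wt (\<lambda>x. F x * G x) (V, r)
    \<le> (\<Sum>s\<in>{1..<r}. \<Sum>W\<in>Pow V. wt F (W, s) * wt G (V - W, r - s))"
proof -
  let ?u = "(1/4) ^ card V * t ^ r"
  have finV: "finite V" using assms finI finite_subset by blast
  have "(F x * G x) $ r = (\<Sum>s\<in>{1..<r}. F x $ s * G x $ (r - s))" if "x \<in> P" for x
    unfolding fps_mult_nth using F0[OF that] G0[OF that]
    by (intro sum.mono_neutral_right) (auto simp: not_le not_less le_Suc_eq)
  then have "D V (\<lambda>x. (F x * G x) $ r) = D V (\<lambda>x. \<Sum>s\<in>{1..<r}. F x $ s * G x $ (r - s))"
    using assms by (intro D_cong) auto
  also have "\<dots> \<le> (\<Sum>s\<in>{1..<r}. D V (\<lambda>x. F x $ s * G x $ (r - s)))"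
    using assms by (intro D_sum bmeas_mult bmeasF_nth)
  also have "\<dots> \<le> (\<Sum>s\<in>{1..<r}. \<Sum>W\<in>Pow V. D W (\<lambda>x. F x $ s) * D (V - W) (\<lambda>x. G x $ (r - s)))"
    using assms by (intro sum_mono D_mult bmeasF_nth)
  finally have "wt (\<lambda>x. F x * G x) (V, r)
      \<le> (\<Sum>s\<in>{1..<r}. \<Sum>W\<in>Pow V. D W (\<lambda>x. F x $ s) * D (V - W) (\<lambda>x. G x $ (r - s))) * ?u"
    unfolding wt_def using t_pos by (simp add: mult.assoc mult_right_mono)
  also have "\<dots> = (\<Sum>s\<in>{1..<r}. \<Sum>W\<in>Pow V. wt F (W, s) * wt G (V - W, r - s))"
    unfolding sum_distrib_right
  proof (intro sum.cong refl)
    fix s W assume s: "s \<in> {1..<r}" and W: "W \<in> Pow V"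
    have "card V = card W + card (V - W)"
      using W finV by (metis PowD card_Diff_subset card_mono finite_subset le_add_diff_inverse)
    moreover have "r = s + (r - s)" using s by auto
    ultimately have u: "?u = (1/4) ^ card W * (1/4) ^ card (V - W) * (t ^ s * t ^ (r - s))"
      by (metis power_add)
    show "D W (\<lambda>x. F x $ s) * D (V - W) (\<lambda>x. G x $ (r - s)) * ?u = wt F (W, s) * wt G (V - W, r - s)"
      unfolding u wt_def by simp
  qed
  finally show ?thesis .
qed

text \<open>
Expanding a product produces one summand for each way to split \<open>(V, r)\<close> into \<open>(W, s)\<close> and
\<open>(V - W, r - s)\<close>. The splitting is injective, so the summands can be compared with those of a product
of sums over any set \<open>T\<close> of pairs that contains all the splittings.
\<close>

lemma wnorm_mult_split:
  assumes "bmeasF F" "bmeasF G" "\<forall>p\<in>Q. fst p \<subseteq> I" "finite Q" 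
    and F0: "\<And>x. x \<in> P \<Longrightarrow> F x $ 0 = 0" and G0: "\<And>x. x \<in> P \<Longrightarrow> G x $ 0 = 0"
    and T: "finite T" "\<forall>(p, q)\<in>T. fst p \<subseteq> I \<and> fst q \<subseteq> I"
    and split: "\<And>V r W s. (V, r) \<in> Q \<Longrightarrow> W \<subseteq> V \<Longrightarrow> 1 \<le> s \<Longrightarrow> s < r \<Longrightarrow> ((W, s), (V - W, r - s)) \<in> T"
  shows "wnorm Q (\<lambda>x. F x * G x) \<le> (\<Sum>(p, q)\<in>T. wt F p * wt G q)"
proof -
  let ?Z = "SIGMA p:Q. SIGMA s:{1..<snd p}. Pow (fst p)"
  let ?\<phi> = "\<lambda>((V::nat set, r::nat), (s::nat, W::nat set)). ((W, s), (V - W, r - s))"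
  have finfst: "finite (fst p)" if "p \<in> Q" for p
    using that assms(3) by (intro finite_subset[OF _ finI]) auto
  have "wnorm Q (\<lambda>x. F x * G x)
      \<le> (\<Sum>p\<in>Q. \<Sum>s\<in>{1..<snd p}. \<Sum>W\<in>Pow (fst p). wt F (W, s) * wt G (fst p - W, snd p - s))"
    unfolding wnorm_def
  proof (rule sum_mono)
    fix p assume "p \<in> Q"
    then show "wt (\<lambda>x. F x * G x) p
      \<le> (\<Sum>s\<in>{1..<snd p}. \<Sum>W\<in>Pow (fst p). wt F (W, s) * wt G (fst p - W, snd p - s))"
      using wt_mult[of F G "fst p" "snd p"] assms by auto
  qed
  also have "\<dots> = (\<Sum>z\<in>?Z. case ?\<phi> z of (p, q) \<Rightarrow> wt F p * wt G q)"
    using finfst assms(4) by (simp add: sum.Sigma case_prod_beta)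
  also have "\<dots> = (\<Sum>(p, q)\<in>?\<phi> ` ?Z. wt F p * wt G q)"
  proof -
    have "inj_on ?\<phi> ?Z"
    proof (rule inj_onI)
      fix z z' assume z: "z \<in> ?Z" "z' \<in> ?Z" "?\<phi> z = ?\<phi> z'"
      obtain V r s W where 1: "z = ((V, r), (s, W))" by (metis surj_pair)
      obtain V' r' s' W' where 2: "z' = ((V', r'), (s', W'))" by (metis surj_pair)
      have "W' = W" "s' = s" "V - W = V' - W" "r - s = r' - s" "W \<subseteq> V" "W \<subseteq> V'" "s < r" "s < r'"
        using z unfolding 1 2 by auto
      moreover from this have "V = V'" "r = r'" by auto
      ultimately show "z = z'" unfolding 1 2 by simp
    qed
    then show ?thesis by (simp add: sum.reindex)
  qed
  also have "\<dots> \<le> (\<Sum>(p, q)\<in>T. wt F p * wt G q)"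
    using T split wt_nonneg assms(1,2) by (intro sum_mono2) auto
  finally show ?thesis .
qed

lemma trunc_idx_fst_subset: "J \<subseteq> I \<Longrightarrow> \<forall>p\<in>trunc_idx J L. fst p \<subseteq> I"
  by (auto simp: trunc_idx_def)

lemma trunc_idx_at_fst_subset: "J \<subseteq> I \<Longrightarrow> \<forall>p\<in>trunc_idx_at J L j. fst p \<subseteq> I"
  by (auto simp: trunc_idx_def trunc_idx_at_def)

lemma wnorm_times_sum:
  "wnorm Q F * wnorm Q' G = (\<Sum>(p, q)\<in>Q \<times> Q'. wt F p * wt G q)"
  unfolding wnorm_def sum_product sum.cartesian_product by simp

lemma trunc_idx_split:
  assumes "finite J" "(V, r) \<in> trunc_idx J (Suc L)" "W \<subseteq> V" "1 \<le> s" "s < r"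
  shows "(W, s) \<in> trunc_idx J L" "(V - W, r - s) \<in> trunc_idx J L"
proof -
  have "card W \<le> card V" "card (V - W) \<le> card V"
    using assms by (auto simp: trunc_idx_def intro!: card_mono intro: finite_subset)
  then show "(W, s) \<in> trunc_idx J L" "(V - W, r - s) \<in> trunc_idx J L"
    using assms by (auto simp: trunc_idx_def)
qed

context
  fixes J :: "nat set" and L :: nat
  assumes J: "J \<subseteq> I"
begin

lemma finJ: "finite J"
  using J finI finite_subset by blast

lemma wnorm_mult:
  assumes "bmeasF F" "bmeasF G"
    and "\<And>x. x \<in> P \<Longrightarrow> F x $ 0 = 0" and "\<And>x. x \<in> P \<Longrightarrow> G x $ 0 = 0"
  shows "wnorm (trunc_idx J (Suc L)) (\<lambda>x. F x * G x) \<le> wnorm (trunc_idx J L) F * wnorm (trunc_idx J L) G"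
  unfolding wnorm_times_sum
  using assms trunc_idx_fst_subset[OF J] trunc_idx_split[OF finJ] finite_trunc_idx[OF finJ]
  by (intro wnorm_mult_split) (auto dest: bspec)

text \<open>
Exactly one of the two parts of \<open>V\<close> contains \<open>j\<close>, so keeping the terms with \<open>j \<in> V\<close> obeys the product
rule of a derivation.
\<close>

lemma wnorm_at_mult:
  assumes "bmeasF F" "bmeasF G"
    and "\<And>x. x \<in> P \<Longrightarrow> F x $ 0 = 0" and "\<And>x. x \<in> P \<Longrightarrow> G x $ 0 = 0"
  shows "wnorm (trunc_idx_at J (Suc L) j) (\<lambda>x. F x * G x)
    \<le> wnorm (trunc_idx_at J L j) F * wnorm (trunc_idx J L) G + wnorm (trunc_idx J L) F * wnorm (trunc_idx_at J L j) G"
proof -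
  let ?K = "trunc_idx J L" and ?B = "trunc_idx_at J L j"
  have fin: "finite ?K" "finite ?B"
    using finite_trunc_idx[OF finJ] finite_trunc_idx_at[OF finJ] by auto
  have sub: "\<forall>p\<in>?K. fst p \<subseteq> I" "\<forall>p\<in>?B. fst p \<subseteq> I"
    using trunc_idx_fst_subset[OF J] trunc_idx_at_fst_subset[OF J] by auto
  have "wnorm (trunc_idx_at J (Suc L) j) (\<lambda>x. F x * G x) \<le> (\<Sum>(p, q)\<in>?B \<times> ?K \<union> ?K \<times> ?B. wt F p * wt G q)"
  proof (rule wnorm_mult_split)
    fix V r W s assume *: "(V, r) \<in> trunc_idx_at J (Suc L) j" "W \<subseteq> V" "1 \<le> s" "s < r"
    then have "(W, s) \<in> ?K" "(V - W, r - s) \<in> ?K" "j \<in> V"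
      using trunc_idx_split[OF finJ, of V r L W s] by (auto simp: trunc_idx_at_def)
    then show "((W, s), (V - W, r - s)) \<in> ?B \<times> ?K \<union> ?K \<times> ?B"
      by (auto simp: trunc_idx_at_def)
    next
    show "\<forall>(p, q)\<in>?B \<times> ?K \<union> ?K \<times> ?B. fst p \<subseteq> I \<and> fst q \<subseteq> I"
      using J by (auto simp: trunc_idx_at_def trunc_idx_def)
  qed (use assms fin finite_trunc_idx_at[OF finJ] trunc_idx_at_fst_subset[OF J] in auto)
  also have "\<dots> \<le> (\<Sum>(p, q)\<in>?B \<times> ?K. wt F p * wt G q) + (\<Sum>(p, q)\<in>?K \<times> ?B. wt F p * wt G q)"
  proof -
    have "0 \<le> (\<Sum>(p, q)\<in>(?B \<times> ?K) \<inter> (?K \<times> ?B). wt F p * wt G q)"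
    proof (rule sum_nonneg)
      fix z assume "z \<in> (?B \<times> ?K) \<inter> (?K \<times> ?B)"
      then have "fst (fst z) \<subseteq> I" "fst (snd z) \<subseteq> I"
        using sub by auto
      then show "0 \<le> (case z of (p, q) \<Rightarrow> wt F p * wt G q)"
        using assms wt_nonneg by (simp add: case_prod_beta)
    qed
    then show ?thesis
      using fin sum.union_inter[of "?B \<times> ?K" "?K \<times> ?B" "\<lambda>(p, q). wt F p * wt G q"] by simp
  qed
  finally show ?thesis by (simp add: wnorm_times_sum)
qed

lemma wnorm_Suc_mono: "bmeasF F \<Longrightarrow> wnorm (trunc_idx J L) F \<le> wnorm (trunc_idx J (Suc L)) F"
  using trunc_idx_fst_subset[OF J] finite_trunc_idx[OF finJ] trunc_idx_mono by (intro wnorm_mono_set) auto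

lemma wnorm_at_Suc_mono: "bmeasF F \<Longrightarrow> wnorm (trunc_idx_at J L j) F \<le> wnorm (trunc_idx_at J (Suc L) j) F"
  using trunc_idx_at_fst_subset[OF J] finite_trunc_idx_at[OF finJ] trunc_idx_at_mono by (intro wnorm_mono_set) auto

lemma wnorm_K_nonneg: "bmeasF F \<Longrightarrow> 0 \<le> wnorm (trunc_idx J L') F"
  using trunc_idx_fst_subset[OF J] wnorm_nonneg by blast

lemma wnorm_at_nonneg: "bmeasF F \<Longrightarrow> 0 \<le> wnorm (trunc_idx_at J L' j) F"
  using trunc_idx_at_fst_subset[OF J] wnorm_nonneg by blast

context
  fixes F :: "(nat \<Rightarrow> 'b) \<Rightarrow> real fps"
  assumes F: "bmeasF F" and F0: "\<And>x. x \<in> P \<Longrightarrow> F x $ 0 = 0"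
begin

lemma wnorm_power_Suc:
  assumes "2 \<le> i"
  shows "wnorm (trunc_idx J (Suc L)) (\<lambda>x. F x ^ i) \<le> wnorm (trunc_idx J L) F ^ i"
  using assms
proof (induction i rule: dec_induct)
  case base
  show ?case using wnorm_mult[OF F F] F0 by (simp add: power2_eq_square)
next
  case (step i)
  let ?a = "wnorm (trunc_idx J L) F"
  have "wnorm (trunc_idx J (Suc L)) (\<lambda>x. F x * F x ^ i) \<le> ?a * wnorm (trunc_idx J L) (\<lambda>x. F x ^ i)"
    using step F F0 by (intro wnorm_mult bmeasF_power) auto
  also have "\<dots> \<le> ?a * ?a ^ i"
    using step.IH wnorm_Suc_mono[OF bmeasF_power[OF F, of i]] wnorm_K_nonneg[OF F]
    by (intro mult_left_mono) auto
  finally show ?case by simp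
qed

lemma wnorm_power:
  assumes "1 \<le> i"
  shows "wnorm (trunc_idx J L) (\<lambda>x. F x ^ i) \<le> wnorm (trunc_idx J L) F ^ i"
proof (cases "i = 1")
  case False
  then show ?thesis
    using wnorm_power_Suc[of i] wnorm_Suc_mono[OF bmeasF_power[OF F, of i]] assms by force
qed simp

lemma wnorm_at_power_Suc:
  assumes "2 \<le> i"
  shows "wnorm (trunc_idx_at J (Suc L) j) (\<lambda>x. F x ^ i)
    \<le> real i * wnorm (trunc_idx J L) F ^ (i - 1) * wnorm (trunc_idx_at J L j) F"
  using assms
proof (induction i rule: dec_induct)
  case base
  show ?case using wnorm_at_mult[OF F F, of j] F0 by (simp add: power2_eq_square algebra_simps)
next
  case (step i)
  let ?a = "wnorm (trunc_idx J L) F" and ?b = "wnorm (trunc_idx_at J L j) F"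
  have nn: "0 \<le> ?a" "0 \<le> ?b"
    using wnorm_K_nonneg[OF F] wnorm_at_nonneg[OF F] by auto
  have "wnorm (trunc_idx_at J (Suc L) j) (\<lambda>x. F x * F x ^ i)
      \<le> ?b * wnorm (trunc_idx J L) (\<lambda>x. F x ^ i) + ?a * wnorm (trunc_idx_at J L j) (\<lambda>x. F x ^ i)"
    using step F F0 by (intro wnorm_at_mult bmeasF_power) auto
  also have "\<dots> \<le> ?b * ?a ^ i + ?a * (real i * ?a ^ (i - 1) * ?b)"
    using step.IH wnorm_at_Suc_mono[OF bmeasF_power[OF F, of i], of j] wnorm_power[of i] nn step.hyps
    by (intro add_mono mult_left_mono) auto
  also have "\<dots> = real (Suc i) * ?a ^ (Suc i - 1) * ?b"
    using step.hyps by (cases i) (auto simp: algebra_simps)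
  finally show ?case by simp
qed

lemma wnorm_at_power:
  assumes "1 \<le> i"
  shows "wnorm (trunc_idx_at J L j) (\<lambda>x. F x ^ i)
    \<le> real i * wnorm (trunc_idx J L) F ^ (i - 1) * wnorm (trunc_idx_at J L j) F"
proof (cases "i = 1")
  case False
  then show ?thesis
    using wnorm_at_power_Suc[of i j] wnorm_at_Suc_mono[OF bmeasF_power[OF F, of i], of j] assms by linarith
qed simp

text \<open>
Since \<open>F\<close> has no constant term, only the powers up to \<open>N\<close> of \<open>F\<close> contribute to coefficients of order
at most \<open>N\<close>, so that the composition is a finite sum.
\<close>

lemma wnorm_compose_le:
  assumes Q: "\<forall>p\<in>Q. fst p \<subseteq> I \<and> 1 \<le> snd p \<and> snd p \<le> N"
  shows "wnorm Q (\<lambda>x. c oo F x) \<le> (\<Sum>i=1..N. \<bar>c $ i\<bar> * wnorm Q (\<lambda>x. F x ^ i))"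
proof -
  have "wt (\<lambda>x. c oo F x) p \<le> (\<Sum>i=1..N. \<bar>c $ i\<bar> * wt (\<lambda>x. F x ^ i) p)" if "p \<in> Q" for p
  proof -
    define V r where "V = fst p" and "r = snd p"
    then have p: "p = (V, r)" "V \<subseteq> I" "1 \<le> r" "r \<le> N"
      using that Q by auto
    have "(c oo F x) $ r = (\<Sum>i=1..N. c $ i * (F x ^ i) $ r)" if "x \<in> P" for x
    proof -
      have "(c oo F x) $ r = (\<Sum>i=0..r. c $ i * (F x ^ i) $ r)"
        by (simp add: fps_compose_nth)
      also have "\<dots> = (\<Sum>i=0..N. c $ i * (F x ^ i) $ r)"
        using startsby_zero_power_prefix[OF F0[OF that]] p by (intro sum.mono_neutral_left) auto
      also have "\<dots> = (\<Sum>i=1..N. c $ i * (F x ^ i) $ r)"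
        using p by (intro sum.mono_neutral_right) (auto simp: Suc_le_eq)
      finally show ?thesis .
    qed
    then have "D V (\<lambda>x. (c oo F x) $ r) = D V (\<lambda>x. \<Sum>i=1..N. c $ i * (F x ^ i) $ r)"
      using p by (intro D_cong) auto
    also have "\<dots> \<le> (\<Sum>i=1..N. D V (\<lambda>x. c $ i * (F x ^ i) $ r))"
      using p F by (intro D_sum bmeas_mult bmeas_const bmeasF_nth bmeasF_power)
    also have "\<dots> \<le> (\<Sum>i=1..N. \<bar>c $ i\<bar> * D V (\<lambda>x. (F x ^ i) $ r))"
      using p F by (intro sum_mono D_cmult bmeasF_nth bmeasF_power)
    finally have "wt (\<lambda>x. c oo F x) p
        \<le> (\<Sum>i=1..N. \<bar>c $ i\<bar> * D V (\<lambda>x. (F x ^ i) $ r)) * ((1/4) ^ card V * t ^ r)"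
      unfolding wt_def p using t_pos by (simp add: mult.assoc mult_right_mono)
    then show ?thesis
      by (simp add: wt_def p sum_distrib_left sum_distrib_right algebra_simps)
  qed
  then have "wnorm Q (\<lambda>x. c oo F x) \<le> (\<Sum>p\<in>Q. \<Sum>i=1..N. \<bar>c $ i\<bar> * wt (\<lambda>x. F x ^ i) p)"
    unfolding wnorm_def by (intro sum_mono)
  also have "\<dots> = (\<Sum>i=1..N. \<bar>c $ i\<bar> * wnorm Q (\<lambda>x. F x ^ i))"
    unfolding wnorm_def by (subst sum.swap) (simp add: sum_distrib_left)
  finally show ?thesis .
qed

end

end

end

section \<open>Truncation error of the exponential of a polynomial\<close>

text \<open>
A pair \<open>(G, g)\<close> of a series and a real number is viewed as a polynomial of degree at most \<open>m\<close>, the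
truncation of \<open>G\<close>, plus a remainder \<open>g - \<Sum>\<^sub>r\<^sub>\<le>\<^sub>m G\<^sub>r\<close> that is treated as a coefficient of order \<open>m + 1\<close>. Multiplying
both components gives an algebra for which the weighted sum of coefficients is submultiplicative.
\<close>

definition jet_norm :: "nat \<Rightarrow> real \<Rightarrow> real fps \<Rightarrow> real \<Rightarrow> real" where
  "jet_norm m t G g = (\<Sum>r\<le>m. \<bar>G $ r\<bar> * t ^ r) + \<bar>g - (\<Sum>r\<le>m. G $ r)\<bar> * t ^ (m + 1)"

text \<open>
Products of coefficients with \<open>i + j \<le> m\<close> are coefficients of \<open>G H\<close>; those with \<open>i + j > m\<close> fall into the
remainder, where \<open>t ^ (m + 1) \<le> t ^ (i + j)\<close> because \<open>t \<ge> 1\<close>.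
\<close>

lemma jet_norm_mult:
  assumes t: "t \<ge> 1"
  shows "jet_norm m t (G * H) (g * h) \<le> jet_norm m t G g * jet_norm m t H h"
proof -
  let ?B = "{..m} \<times> {..m}" and ?L = "{(i, j). i + j \<le> m}" and ?q = "t ^ (m + 1)"
  let ?U = "?B - ?L"
  define \<rho> where "\<rho> = g - (\<Sum>r\<le>m. G $ r)"
  define \<sigma> where "\<sigma> = h - (\<Sum>r\<le>m. H $ r)"
  define A where "A = (\<Sum>r\<le>m. \<bar>G $ r\<bar> * t ^ r)"
  define A' where "A' = (\<Sum>r\<le>m. \<bar>H $ r\<bar> * t ^ r)"
  have fin: "finite ?B" "?L \<subseteq> ?B" by auto
  have split: "sum f ?B = sum f ?L + sum f ?U" for f :: "nat \<times> nat \<Rightarrow> real"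
    using fin by (simp add: sum.subset_diff add.commute)
  have low: "(\<Sum>r\<le>m. \<bar>(G * H) $ r\<bar> * t ^ r) \<le> (\<Sum>(i, j)\<in>?L. \<bar>G $ i\<bar> * \<bar>H $ j\<bar> * t ^ (i + j))"
  proof -
    have "(\<Sum>r\<le>m. \<bar>(G * H) $ r\<bar> * t ^ r) \<le> (\<Sum>r\<le>m. \<Sum>i\<le>r. \<bar>G $ i\<bar> * \<bar>H $ (r - i)\<bar> * t ^ (i + (r - i)))"
    proof (rule sum_mono)
      fix r
      have "\<bar>(G * H) $ r\<bar> \<le> (\<Sum>i\<le>r. \<bar>G $ i\<bar> * \<bar>H $ (r - i)\<bar>)"
        unfolding fps_mult_nth atLeast0AtMost abs_mult[symmetric] by (rule sum_abs)
      then have "\<bar>(G * H) $ r\<bar> * t ^ r \<le> (\<Sum>i\<le>r. \<bar>G $ i\<bar> * \<bar>H $ (r - i)\<bar>) * t ^ r"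
        using t by (intro mult_right_mono) auto
      then show "\<bar>(G * H) $ r\<bar> * t ^ r \<le> (\<Sum>i\<le>r. \<bar>G $ i\<bar> * \<bar>H $ (r - i)\<bar> * t ^ (i + (r - i)))"
        by (simp add: sum_distrib_right)
    qed
    then show ?thesis
      by (simp only: sum.triangle_reindex_eq)
  qed
  have "(\<Sum>r\<le>m. (G * H) $ r) = (\<Sum>(i, j)\<in>?L. G $ i * H $ j)"
    unfolding sum.triangle_reindex_eq fps_mult_nth atLeast0AtMost ..
  moreover have "(\<Sum>r\<le>m. G $ r) * (\<Sum>r\<le>m. H $ r) = (\<Sum>(i, j)\<in>?B. G $ i * H $ j)"
    by (simp add: sum_product sum.cartesian_product)
  ultimately have "g * h - (\<Sum>r\<le>m. (G * H) $ r)
      = (\<Sum>(i, j)\<in>?U. G $ i * H $ j) + (\<Sum>r\<le>m. G $ r) * \<sigma> + \<rho> * (\<Sum>r\<le>m. H $ r) + \<rho> * \<sigma>"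
    using split[of "\<lambda>(i, j). G $ i * H $ j"] by (simp add: \<rho>_def \<sigma>_def algebra_simps)
  also have "\<bar>\<dots>\<bar> * ?q \<le> (\<Sum>(i, j)\<in>?U. \<bar>G $ i\<bar> * \<bar>H $ j\<bar> * t ^ (i + j)) 
      + A * (\<bar>\<sigma>\<bar> * ?q) + (\<bar>\<rho>\<bar> * ?q) * A' + (\<bar>\<rho>\<bar> * ?q) * (\<bar>\<sigma>\<bar> * ?q)"
  proof -
    have 1: "\<bar>\<Sum>(i, j)\<in>?U. G $ i * H $ j\<bar> * ?q \<le> (\<Sum>(i, j)\<in>?U. \<bar>G $ i\<bar> * \<bar>H $ j\<bar> * t ^ (i + j))"
    proof -
      have "\<bar>\<Sum>(i, j)\<in>?U. G $ i * H $ j\<bar> \<le> (\<Sum>(i, j)\<in>?U. \<bar>G $ i\<bar> * \<bar>H $ j\<bar>)"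
        by (rule order_trans[OF sum_abs]) (simp add: case_prod_beta abs_mult)
      then have "\<bar>\<Sum>(i, j)\<in>?U. G $ i * H $ j\<bar> * ?q \<le> (\<Sum>(i, j)\<in>?U. \<bar>G $ i\<bar> * \<bar>H $ j\<bar>) * ?q"
        using t by (intro mult_right_mono) auto
      also have "\<dots> = (\<Sum>(i, j)\<in>?U. \<bar>G $ i\<bar> * \<bar>H $ j\<bar> * ?q)"
        by (simp add: sum_distrib_right case_prod_beta)
      also have "\<dots> \<le> (\<Sum>(i, j)\<in>?U. \<bar>G $ i\<bar> * \<bar>H $ j\<bar> * t ^ (i + j))"
      proof (rule sum_mono)
        fix z assume "z \<in> ?U"
        then have "m + 1 \<le> fst z + snd z" by auto
        then have "?q \<le> t ^ (fst z + snd z)"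
          using t by (rule power_increasing)
        then show "(case z of (i, j) \<Rightarrow> \<bar>G $ i\<bar> * \<bar>H $ j\<bar> * ?q)
            \<le> (case z of (i, j) \<Rightarrow> \<bar>G $ i\<bar> * \<bar>H $ j\<bar> * t ^ (i + j))"
          by (simp only: case_prod_beta) (intro mult_left_mono; simp)
      qed
      finally show ?thesis .
    qed
    have abs_le: "\<bar>\<Sum>r\<le>m. K $ r\<bar> \<le> (\<Sum>r\<le>m. \<bar>K $ r\<bar> * t ^ r)" for K :: "real fps"
    proof -
      have "\<bar>K $ r\<bar> * 1 \<le> \<bar>K $ r\<bar> * t ^ r" for r
        using t by (intro mult_left_mono) auto
      then show ?thesis
        by (intro order_trans[OF sum_abs sum_mono]) auto
    qed
    have q: "1 \<le> ?q" using t by (rule one_le_power)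
    have 2: "\<bar>(\<Sum>r\<le>m. G $ r) * \<sigma>\<bar> * ?q \<le> A * (\<bar>\<sigma>\<bar> * ?q)"
      using abs_le[of G] q by (simp add: abs_mult mult.assoc A_def mult_right_mono)
    have 3: "\<bar>\<rho> * (\<Sum>r\<le>m. H $ r)\<bar> * ?q \<le> (\<bar>\<rho>\<bar> * ?q) * A'"
    proof -
      have "0 \<le> \<bar>\<rho>\<bar> * ?q" using t by simp
      from mult_left_mono[OF abs_le[of H] this] show ?thesis
        by (simp add: abs_mult mult_ac A'_def)
    qed
    have "\<bar>\<rho>\<bar> * \<bar>\<sigma>\<bar> * ?q * 1 \<le> \<bar>\<rho>\<bar> * \<bar>\<sigma>\<bar> * ?q * ?q"
      using q by (intro mult_left_mono) auto
    then have 4: "\<bar>\<rho> * \<sigma>\<bar> * ?q \<le> (\<bar>\<rho>\<bar> * ?q) * (\<bar>\<sigma>\<bar> * ?q)"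
      by (simp add: abs_mult mult_ac)
    have tri: "\<bar>a + b + c + d\<bar> * q \<le> \<bar>a\<bar> * q + \<bar>b\<bar> * q + \<bar>c\<bar> * q + \<bar>d\<bar> * q" if "q \<ge> 1" for a b c d q :: real
    proof -
      have "\<bar>a + b + c + d\<bar> * q \<le> (\<bar>a\<bar> + \<bar>b\<bar> + \<bar>c\<bar> + \<bar>d\<bar>) * q"
        using that by (intro mult_right_mono) auto
      then show ?thesis by (simp add: algebra_simps)
    qed
    show ?thesis
      by (rule order_trans[OF tri[OF q] add_mono[OF add_mono[OF add_mono[OF 1 2] 3] 4]])
  qed
  finally have "jet_norm m t (G * H) (g * h) \<le> (\<Sum>(i, j)\<in>?B. \<bar>G $ i\<bar> * \<bar>H $ j\<bar> * t ^ (i + j))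
      + A * (\<bar>\<sigma>\<bar> * ?q) + (\<bar>\<rho>\<bar> * ?q) * A' + (\<bar>\<rho>\<bar> * ?q) * (\<bar>\<sigma>\<bar> * ?q)"
    unfolding jet_norm_def split using low by linarith
  also have "(\<Sum>(i, j)\<in>?B. \<bar>G $ i\<bar> * \<bar>H $ j\<bar> * t ^ (i + j)) = A * A'"
    by (simp add: A_def A'_def sum_product sum.cartesian_product power_add mult_ac)
  also have "A * A' + A * (\<bar>\<sigma>\<bar> * ?q) + (\<bar>\<rho>\<bar> * ?q) * A' + (\<bar>\<rho>\<bar> * ?q) * (\<bar>\<sigma>\<bar> * ?q)
      = jet_norm m t G g * jet_norm m t H h"
    unfolding jet_norm_def A_def[symmetric] A'_def[symmetric] \<rho>_def[symmetric] \<sigma>_def[symmetric]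
    by (simp only: distrib_left distrib_right add_ac)
  finally show ?thesis .
qed

lemma jet_norm_power:
  assumes "t \<ge> 1"
  shows "jet_norm m t (G ^ i) (g ^ i) \<le> jet_norm m t G g ^ i"
proof (induction i)
  case 0
  have "(\<Sum>r\<le>m. \<bar>(1 :: real fps) $ r\<bar> * t ^ r) = (\<Sum>r\<in>{0}. \<bar>(1 :: real fps) $ r\<bar> * t ^ r)"
    by (rule sum.mono_neutral_right) auto
  moreover have "(\<Sum>r\<le>m. (1 :: real fps) $ r) = (\<Sum>r\<in>{0}. (1 :: real fps) $ r)"
    by (rule sum.mono_neutral_right) auto
  ultimately show ?case by (simp add: jet_norm_def)
next
  case (Suc i)
  have "0 \<le> jet_norm m t G g"
    using assms by (simp add: jet_norm_def sum_nonneg)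
  then show ?case
    using order_trans[OF jet_norm_mult[OF assms, of m G "G ^ i" g "g ^ i"] mult_left_mono[OF Suc]]
    by simp
qed

text \<open>
Take \<open>g\<close> to be the value of the truncation of \<open>F\<close> itself, so that the initial remainder vanishes.
Submultiplicativity then bounds the remainder of every power \<open>F ^ i\<close> by \<open>a ^ i / t ^ (m + 1)\<close>, and these bounds are
summed against \<open>1 / i!\<close>. The power \<open>i = 0\<close> has no remainder, whence \<open>exp a - 1\<close>.
\<close>

lemma exp_truncation_error:
  fixes F :: "real fps"
  assumes t: "t \<ge> 1" and F0: "F $ 0 = 0" and a: "(\<Sum>r=1..m. \<bar>F $ r\<bar> * t ^ r) \<le> a"
  shows "\<bar>exp (\<Sum>r=1..m. F $ r) - (\<Sum>r\<le>m. fps_Exp F $ r)\<bar> \<le> (exp a - 1) / t ^ (m + 1)"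
proof -
  define f where "f = (\<Sum>r=1..m. F $ r)"
  define T where "T i = (\<Sum>r\<le>m. (F ^ i) $ r)" for i
  have cut: "(\<Sum>r\<le>m. h r) = (\<Sum>r=1..m. h r)" if "h 0 = 0" for h :: "nat \<Rightarrow> real"
    using that by (intro sum.mono_neutral_right) (auto simp: Suc_le_eq)
  have "jet_norm m t F f \<le> a"
    using a F0 by (simp add: jet_norm_def f_def cut)
  moreover have "0 \<le> jet_norm m t F f"
    using t by (simp add: jet_norm_def sum_nonneg)
  ultimately have "jet_norm m t (F ^ i) (f ^ i) \<le> a ^ i" for i
    using jet_norm_power[OF t, of m F i f] power_mono order_trans by metis
  moreover have "\<bar>f ^ i - T i\<bar> * t ^ (m + 1) \<le> jet_norm m t (F ^ i) (f ^ i)" for i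
    using t by (simp add: jet_norm_def T_def sum_nonneg)
  ultimately have T_err: "\<bar>f ^ i - T i\<bar> \<le> a ^ i / t ^ (m + 1)" for i
    using t order_trans by (simp add: pos_le_divide_eq) blast
  have T0: "T 0 = 1"
    using sum.mono_neutral_right[of "{..m}" "{0}" "\<lambda>r. (1 :: real fps) $ r"] by (simp add: T_def)
  have Tbig: "T i = 0" if "i > m" for i
    unfolding T_def using that startsby_zero_power_prefix[OF F0] by (intro sum.neutral) auto
  have "(\<Sum>r\<le>m. fps_Exp F $ r) = (\<Sum>r\<le>m. \<Sum>i\<le>m. (F ^ i) $ r / fact i)"
  proof (rule sum.cong[OF refl])
    fix r assume "r \<in> {..m}"
    have "fps_Exp F $ r = (\<Sum>i=0..r. (F ^ i) $ r / fact i)"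
      by (simp add: fps_Exp_def fps_compose_nth)
    also have "\<dots> = (\<Sum>i\<le>m. (F ^ i) $ r / fact i)"
      using \<open>r \<in> {..m}\<close> startsby_zero_power_prefix[OF F0]
      by (intro sum.mono_neutral_left) auto
    finally show "fps_Exp F $ r = (\<Sum>i\<le>m. (F ^ i) $ r / fact i)" .
  qed
  also have "\<dots> = (\<Sum>i\<le>m. T i / fact i)"
    unfolding T_def by (subst sum.swap) (simp add: sum_divide_distrib)
  finally have E: "(\<lambda>i. T i / fact i) sums (\<Sum>r\<le>m. fps_Exp F $ r)"
    using sums_finite[of "{..m}" "\<lambda>i. T i / fact i"] Tbig by simp
  have "(\<lambda>i. f ^ i / fact i) sums exp f"
    using exp_converges[of f] by (simp add: field_simps)
  from sums_diff[OF this E] have d: "(\<lambda>i. (f ^ i - T i) / fact i) sums (exp f - (\<Sum>r\<le>m. fps_Exp F $ r))"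
    by (simp add: diff_divide_distrib)
  have "(\<lambda>i. a ^ i / fact i) sums exp a"
    using exp_converges[of a] by (simp add: field_simps)
  then have "(\<lambda>i. a ^ i / fact i - (if i = 0 then 1 else 0)) sums (exp a - 1)"
    by (intro sums_diff sums_single[of 0 "\<lambda>_. 1", simplified])
  from sums_divide[OF this, of "t ^ (m + 1)"]
  have e: "(\<lambda>i. (a ^ i / fact i - (if i = 0 then 1 else 0)) / t ^ (m + 1)) sums ((exp a - 1) / t ^ (m + 1))" .
  have le: "\<bar>(f ^ i - T i) / fact i\<bar> \<le> (a ^ i / fact i - (if i = 0 then 1 else 0)) / t ^ (m + 1)" for i
  proof (cases "i = 0")
    case False
    have "\<bar>f ^ i - T i\<bar> / fact i \<le> a ^ i / t ^ (m + 1) / fact i"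
      using T_err by (intro divide_right_mono) auto
    then show ?thesis using False by (simp add: mult.commute)
  qed (simp add: T0)
  have "exp f - (\<Sum>r\<le>m. fps_Exp F $ r) \<le> (exp a - 1) / t ^ (m + 1)"
    using abs_le_D1[OF le] by (rule sums_le[OF _ d e])
  moreover have "- (exp f - (\<Sum>r\<le>m. fps_Exp F $ r)) \<le> (exp a - 1) / t ^ (m + 1)"
    using abs_le_D2[OF le] by (rule sums_le[OF _ sums_minus[OF d] e])
  ultimately show ?thesis by (simp add: f_def abs_le_iff)
qed

lemma sum_geometric_le:
  fixes a :: real
  assumes "0 \<le> a" "a < 1"
  shows "(\<Sum>i<N. a ^ i) \<le> 1 / (1 - a)"
  using assms by (simp add: sum_gp_strict divide_right_mono)

lemma sum_power_from_1_le:
  fixes a :: real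
  assumes "0 \<le> a" "a < 1"
  shows "(\<Sum>i=1..N. a ^ (i - 1)) \<le> 1 / (1 - a)" 
  using sum_geometric_le[OF assms, of N]
  by (simp add: sum.atLeast1_atMost_eq)

lemma sum_power_from_2_le:
  fixes a :: real
  assumes "0 \<le> a" "a < 1"
  shows "(\<Sum>i=2..N. a ^ (i - 1)) \<le> a / (1 - a)" 
proof -
  have "(\<Sum>i=2..N. a ^ (i - 1)) \<le> (\<Sum>i=2..Suc N. a ^ (i - 1))"
    using assms by (intro sum_mono2) auto
  also have "\<dots> = a * (\<Sum>i=1..N. a ^ (i - 1))"
  proof -
    have "(\<Sum>i=2..Suc N. a ^ (i - 1)) = (\<Sum>i=1..N. a ^ i)"
      using sum.shift_bounds_cl_Suc_ivl[of "\<lambda>i. a ^ (i - 1)" 1 N] by (simp add: numeral_2_eq_2)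
    also have "\<dots> = (\<Sum>i=1..N. a * a ^ (i - 1))"
      by (intro sum.cong refl) (simp add: power_eq_if)
    finally show ?thesis by (simp add: sum_distrib_left)
  qed
  also have "\<dots> \<le> a * (1 / (1 - a))"
    using sum_power_from_1_le[OF assms] assms by (intro mult_left_mono) auto
  finally show ?thesis by simp
qed

section \<open>Averaging over one coordinate\<close>

context weighted_product_law
begin

text \<open>
The bound \<open>1 / i\<close> on the coefficients holds for both \<open>exp\<close> and \<open>log (1 + \<cdot>)\<close>, and it absorbs the factor \<open>i\<close>
that the derivation rule produces on an \<open>i\<close>-th power.
\<close>

lemma wnorm_compose:
  fixes c :: "real fps"
  assumes J: "J \<subseteq> I" and F: "bmeasF F" and F0: "\<And>x. x \<in> P \<Longrightarrow> F x $ 0 = 0"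
    and c: "\<And>i. i \<ge> 1 \<Longrightarrow> \<bar>c $ i\<bar> \<le> 1 / real i"
    and a: "wnorm (trunc_idx J L) F \<le> a" "a < 1"
  shows "wnorm (trunc_idx J L) (\<lambda>x. c oo F x) \<le> a / (1 - a)"
    and "wnorm (trunc_idx_at J L j) (\<lambda>x. c oo F x) \<le> wnorm (trunc_idx_at J L j) F / (1 - a)"
proof -
  let ?a = "wnorm (trunc_idx J L) F" and ?b = "wnorm (trunc_idx_at J L j) F"
  have a0: "0 \<le> ?a" and b0: "0 \<le> ?b"
    using wnorm_K_nonneg[OF J F] wnorm_at_nonneg[OF J F] by auto
  have a0': "0 \<le> a" using a0 a by linarith
  have "wnorm (trunc_idx J L) (\<lambda>x. c oo F x) \<le> (\<Sum>i=1..L. \<bar>c $ i\<bar> * wnorm (trunc_idx J L) (\<lambda>x. F x ^ i))"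
    using J F F0 by (intro wnorm_compose_le) (auto simp: trunc_idx_def)
  also have "\<dots> \<le> (\<Sum>i=1..L. a * a ^ (i - 1))"
  proof (rule sum_mono)
    fix i assume i: "i \<in> {1..L}"
    have "wnorm (trunc_idx J L) (\<lambda>x. F x ^ i) \<le> a ^ i"
      using wnorm_power[OF J F F0, of i L] power_mono[OF a(1) a0, of i] i by force
    moreover have c1': "\<bar>c $ i\<bar> \<le> 1"
      using c[of i] i by (auto intro: order_trans)
    ultimately have "\<bar>c $ i\<bar> * wnorm (trunc_idx J L) (\<lambda>x. F x ^ i) \<le> 1 * a ^ i"
      using c1' i wnorm_K_nonneg[OF J bmeasF_power[OF F]] by (intro mult_mono) auto
    then show "\<bar>c $ i\<bar> * wnorm (trunc_idx J L) (\<lambda>x. F x ^ i) \<le> a * a ^ (i - 1)"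
      using i by (simp add: power_eq_if)
  qed
  also have "\<dots> = a * (\<Sum>i=1..L. a ^ (i - 1))"
    by (simp only: sum_distrib_left)
  also have "\<dots> \<le> a * (1 / (1 - a))"
    using a0' a by (intro mult_left_mono sum_power_from_1_le) auto
  finally show "wnorm (trunc_idx J L) (\<lambda>x. c oo F x) \<le> a / (1 - a)" by simp
  have "wnorm (trunc_idx_at J L j) (\<lambda>x. c oo F x)
      \<le> (\<Sum>i=1..L. \<bar>c $ i\<bar> * wnorm (trunc_idx_at J L j) (\<lambda>x. F x ^ i))"
    using J F F0 by (intro wnorm_compose_le) (auto simp: trunc_idx_def trunc_idx_at_def)
  also have "\<dots> \<le> (\<Sum>i=1..L. ?b * a ^ (i - 1))"
  proof (rule sum_mono)
    fix i assume i: "i \<in> {1..L}"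
    have "wnorm (trunc_idx_at J L j) (\<lambda>x. F x ^ i) \<le> real i * ?a ^ (i - 1) * ?b"
      using wnorm_at_power[OF J F F0, of i L j] i by simp
    also have "\<dots> \<le> real i * a ^ (i - 1) * ?b"
      using a a0 b0 by (intro mult_right_mono mult_left_mono power_mono) auto
    finally have "\<bar>c $ i\<bar> * wnorm (trunc_idx_at J L j) (\<lambda>x. F x ^ i) \<le> 1 / real i * (real i * a ^ (i - 1) * ?b)"
      using c[of i] i wnorm_at_nonneg[OF J bmeasF_power[OF F]] by (intro mult_mono) auto
    then show "\<bar>c $ i\<bar> * wnorm (trunc_idx_at J L j) (\<lambda>x. F x ^ i) \<le> ?b * a ^ (i - 1)"
      using i by (simp add: mult.commute)
  qed
  also have "\<dots> = ?b * (\<Sum>i=1..L. a ^ (i - 1))"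
    by (simp only: sum_distrib_left)
  also have "\<dots> \<le> ?b * (1 / (1 - a))"
    using b0 a0' a by (intro mult_left_mono sum_power_from_1_le) auto
  finally show "wnorm (trunc_idx_at J L j) (\<lambda>x. c oo F x) \<le> ?b / (1 - a)" by simp
qed

text \<open>
Without a linear term every summand is a product of at least two factors. This gains a factor \<open>a\<close>
and allows one more order than is known for \<open>F\<close>.
\<close>

lemma wnorm_compose_Suc:
  fixes c :: "real fps"
  assumes J: "J \<subseteq> I" and F: "bmeasF F" and F0: "\<And>x. x \<in> P \<Longrightarrow> F x $ 0 = 0"
    and c: "\<And>i. i \<ge> 1 \<Longrightarrow> \<bar>c $ i\<bar> \<le> 1 / real i" and c1: "c $ 1 = 0"
    and a: "wnorm (trunc_idx J L) F \<le> a" "a < 1"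
  shows "wnorm (trunc_idx J (Suc L)) (\<lambda>x. c oo F x) \<le> a\<^sup>2 / (1 - a)"
    and "wnorm (trunc_idx_at J (Suc L) j) (\<lambda>x. c oo F x) \<le> a * wnorm (trunc_idx_at J L j) F / (1 - a)"
proof -
  let ?a = "wnorm (trunc_idx J L) F" and ?b = "wnorm (trunc_idx_at J L j) F"
  have a0: "0 \<le> ?a" and b0: "0 \<le> ?b"
    using wnorm_K_nonneg[OF J F] wnorm_at_nonneg[OF J F] by auto
  have a0': "0 \<le> a" using a0 a by linarith
  have from2: "(\<Sum>i=1..Suc L. \<bar>c $ i\<bar> * h i) = (\<Sum>i=2..Suc L. \<bar>c $ i\<bar> * h i)" for h :: "nat \<Rightarrow> real"
    using c1 by (intro sum.mono_neutral_right) (auto simp: not_le less_Suc_eq numeral_2_eq_2)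
  have "wnorm (trunc_idx J (Suc L)) (\<lambda>x. c oo F x)
      \<le> (\<Sum>i=1..Suc L. \<bar>c $ i\<bar> * wnorm (trunc_idx J (Suc L)) (\<lambda>x. F x ^ i))"
    using J F F0 by (intro wnorm_compose_le) (auto simp: trunc_idx_def)
  also have "\<dots> \<le> (\<Sum>i=2..Suc L. a * a ^ (i - 1))"
    unfolding from2
  proof (rule sum_mono)
    fix i assume i: "i \<in> {2..Suc L}"
    have "wnorm (trunc_idx J (Suc L)) (\<lambda>x. F x ^ i) \<le> a ^ i"
      using wnorm_power_Suc[OF J F F0, of i L] power_mono[OF a(1) a0, of i] i by force
    moreover have c1': "\<bar>c $ i\<bar> \<le> 1"
      using c[of i] i by (auto intro: order_trans)
    ultimately have "\<bar>c $ i\<bar> * wnorm (trunc_idx J (Suc L)) (\<lambda>x. F x ^ i) \<le> 1 * a ^ i"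
      using c1' i wnorm_K_nonneg[OF J bmeasF_power[OF F]] by (intro mult_mono) auto
    then show "\<bar>c $ i\<bar> * wnorm (trunc_idx J (Suc L)) (\<lambda>x. F x ^ i) \<le> a * a ^ (i - 1)"
      using i by (simp add: power_eq_if)
  qed
  also have "\<dots> = a * (\<Sum>i=2..Suc L. a ^ (i - 1))"
    by (simp only: sum_distrib_left)
  also have "\<dots> \<le> a * (a / (1 - a))"
    using a0' a by (intro mult_left_mono sum_power_from_2_le) auto
  finally show "wnorm (trunc_idx J (Suc L)) (\<lambda>x. c oo F x) \<le> a\<^sup>2 / (1 - a)"
    by (simp add: power2_eq_square)
  have "wnorm (trunc_idx_at J (Suc L) j) (\<lambda>x. c oo F x)
      \<le> (\<Sum>i=1..Suc L. \<bar>c $ i\<bar> * wnorm (trunc_idx_at J (Suc L) j) (\<lambda>x. F x ^ i))"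
    using J F F0 by (intro wnorm_compose_le) (auto simp: trunc_idx_def trunc_idx_at_def)
  also have "\<dots> \<le> (\<Sum>i=2..Suc L. ?b * a ^ (i - 1))"
    unfolding from2
  proof (rule sum_mono)
    fix i assume i: "i \<in> {2..Suc L}"
    have "wnorm (trunc_idx_at J (Suc L) j) (\<lambda>x. F x ^ i) \<le> real i * ?a ^ (i - 1) * ?b"
      using wnorm_at_power_Suc[OF J F F0, of i L j] i by simp
    also have "\<dots> \<le> real i * a ^ (i - 1) * ?b"
      using a a0 b0 by (intro mult_right_mono mult_left_mono power_mono) auto
    finally have "\<bar>c $ i\<bar> * wnorm (trunc_idx_at J (Suc L) j) (\<lambda>x. F x ^ i)
        \<le> 1 / real i * (real i * a ^ (i - 1) * ?b)"
      using c[of i] i wnorm_at_nonneg[OF J bmeasF_power[OF F]] by (intro mult_mono) auto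
    then show "\<bar>c $ i\<bar> * wnorm (trunc_idx_at J (Suc L) j) (\<lambda>x. F x ^ i) \<le> ?b * a ^ (i - 1)"
      using i by (simp add: mult.commute)
  qed
  also have "\<dots> = ?b * (\<Sum>i=2..Suc L. a ^ (i - 1))"
    by (simp only: sum_distrib_left)
  also have "\<dots> \<le> ?b * (a / (1 - a))"
    using b0 a0' a by (intro mult_left_mono sum_power_from_2_le) auto
  finally show "wnorm (trunc_idx_at J (Suc L) j) (\<lambda>x. c oo F x) \<le> a * ?b / (1 - a)"
    by (simp add: mult.commute)
qed

lemma fps_exp_coeff_le: "i \<ge> 1 \<Longrightarrow> \<bar>(fps_exp 1 - 1 :: real fps) $ i\<bar> \<le> 1 / real i"
proof -
  assume i: "i \<ge> 1"
  have "real i \<le> fact i"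
    by (metis fact_ge_self of_nat_fact of_nat_le_iff)
  then have "1 / fact i \<le> 1 / real i"
    using i by (intro divide_left_mono) auto
  then show ?thesis
    using i by simp
qed

lemma fps_ln_coeff_le: "i \<ge> 1 \<Longrightarrow> \<bar>(fps_ln 1 :: real fps) $ i\<bar> \<le> 1 / real i"
  by (simp add: fps_ln_nth power_abs)

lemma coeff_le_minus_X:
  "c $ 1 = (1::real) \<Longrightarrow> (\<And>i. i \<ge> 1 \<Longrightarrow> \<bar>c $ i\<bar> \<le> 1 / real i) \<Longrightarrow> i \<ge> 1 \<Longrightarrow> \<bar>(c - fps_X) $ i\<bar> \<le> 1 / real i"
  by (cases "i = 1") auto

text \<open>
The terms with \<open>V = {}\<close> of the norm are the suprema of the coefficients.
\<close>

lemma abs_coeff_sum_le_wnorm: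
  assumes "bmeasF G" "x \<in> P" and J: "J \<subseteq> I"
  shows "(\<Sum>r=1..L. \<bar>G x $ r\<bar> * t ^ r) \<le> wnorm (trunc_idx J L) G"
proof -
  have "(\<Sum>r=1..L. \<bar>G x $ r\<bar> * t ^ r) \<le> (\<Sum>r=1..L. wt G ({}, r))"
  proof (rule sum_mono)
    fix r
    have "\<bar>G x $ r\<bar> * t ^ r \<le> D {} (\<lambda>x. G x $ r) * t ^ r"
      using abs_le_D_empty[OF bmeasF_nth[OF assms(1), of r] assms(2)] t_pos
      by (intro mult_right_mono) auto
    then show "\<bar>G x $ r\<bar> * t ^ r \<le> wt G ({}, r)"
      by (simp add: wt_def)
  qed
  also have "\<dots> = wnorm ((\<lambda>r. ({}, r)) ` {1..L}) G"
    unfolding wnorm_def by (simp add: sum.reindex inj_on_def)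
  also have "\<dots> \<le> wnorm (trunc_idx J L) G"
    using assms trunc_idx_fst_subset[OF J] finite_trunc_idx[OF finJ[OF J]]
    by (intro wnorm_mono_set) (auto simp: trunc_idx_def)
  finally show ?thesis .
qed

lemma coeff_sum_abs_le:
  assumes "(\<Sum>r=1..L. \<bar>h r\<bar> * t ^ r) \<le> c" "t \<ge> 1"
  shows "\<bar>\<Sum>r=1..L. h r\<bar> \<le> c"
proof -
  have "\<bar>h r\<bar> * 1 \<le> \<bar>h r\<bar> * t ^ r" for r
    using assms(2) by (intro mult_left_mono) auto
  then have "\<bar>\<Sum>r=1..L. h r\<bar> \<le> (\<Sum>r=1..L. \<bar>h r\<bar> * t ^ r)"
    by (intro order_trans[OF sum_abs sum_mono]) auto
  then show ?thesis using assms(1) by simp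
qed

lemma coeff_sum_abs_le_small_t:
  assumes "(\<Sum>r=1..L. \<bar>h r\<bar> * t ^ r) \<le> c" "t < 1"
  shows "\<bar>\<Sum>r=1..L. h r\<bar> \<le> c / t ^ L"
proof -
  have "\<bar>h r\<bar> * t ^ L \<le> \<bar>h r\<bar> * t ^ r" if "r \<in> {1..L}" for r
    using assms(2) t_pos that by (intro mult_left_mono power_decreasing) auto
  then have "(\<Sum>r=1..L. \<bar>h r\<bar>) * t ^ L \<le> (\<Sum>r=1..L. \<bar>h r\<bar> * t ^ r)"
    unfolding sum_distrib_right by (intro sum_mono)
  moreover have "\<bar>\<Sum>r=1..L. h r\<bar> * t ^ L \<le> (\<Sum>r=1..L. \<bar>h r\<bar>) * t ^ L"
    using t_pos by (intro mult_right_mono sum_abs) auto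
  ultimately have "\<bar>\<Sum>r=1..L. h r\<bar> * t ^ L \<le> c"
    using assms(1) by linarith
  then show ?thesis
    using t_pos by (simp add: pos_le_divide_eq)
qed

text \<open>
If \<open>w = \<tau> g\<close>, this is the cumulant generating function of \<open>g\<close> over coordinate \<open>k\<close>. General series \<open>w\<close> are
admitted because earlier averages leave a series in \<open>\<tau>\<close> and not a multiple of \<open>\<tau>\<close>.
\<close>

definition cgf :: "nat \<Rightarrow> ((nat \<Rightarrow> 'b) \<Rightarrow> real fps) \<Rightarrow> (nat \<Rightarrow> 'b) \<Rightarrow> real fps" where
  "cgf k w x = fps_Ln (avgF k (\<lambda>x. fps_Exp (w x)) x)"

lemma bmeasF_cgf: "k \<in> I \<Longrightarrow> bmeasF w \<Longrightarrow> bmeasF (cgf k w)"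
  unfolding cgf_def fps_Ln_def fps_Exp_def
  by (intro bmeasF_compose bmeasF_diff bmeasF_avgF bmeasF_const)

context
  fixes k :: nat and J :: "nat set" and m :: nat and w :: "(nat \<Rightarrow> 'b) \<Rightarrow> real fps"
  assumes k: "k \<in> I" "k \<notin> J" and J: "J \<subseteq> I" and w: "bmeasF w" and w0: "\<And>x. x \<in> P \<Longrightarrow> w x $ 0 = 0"
    and a: "wnorm (trunc_idx J m) w \<le> 1 / 12"
begin

definition avg_exp_m1 :: "(nat \<Rightarrow> 'b) \<Rightarrow> real fps" where
  "avg_exp_m1 = avgF k (\<lambda>x. (fps_exp 1 - 1) oo w x)"

lemma bmeasF_avg_exp_m1: "bmeasF avg_exp_m1"
  unfolding avg_exp_m1_def using k w by (intro bmeasF_avgF bmeasF_compose)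

lemma avg_exp_m1_0: "x \<in> P \<Longrightarrow> avg_exp_m1 x $ 0 = 0"
  by (simp add: avg_exp_m1_def)

lemma avgF_Exp_eq:
  assumes "x \<in> P" shows "avgF k (\<lambda>x. fps_Exp (w x)) x = 1 + avg_exp_m1 x"
proof (rule fps_ext)
  fix r
  have e: "fps_Exp (w z) $ r = (1 :: real fps) $ r + ((fps_exp 1 - 1) oo w z) $ r" for z
    by (simp add: fps_Exp_def fps_compose_sub_distrib)
  show "avgF k (\<lambda>x. fps_Exp (w x)) x $ r = (1 + avg_exp_m1 x) $ r"
    unfolding avgF_nth e using assms k w by (simp add: avg_add avg_exp_m1_def bmeasF_nth bmeasF_compose)
qed

lemma cgf_eq: "x \<in> P \<Longrightarrow> cgf k w x = fps_ln 1 oo avg_exp_m1 x"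
  by (simp add: cgf_def fps_Ln_def avgF_Exp_eq)

lemma bmeasF_cgf_P: "bmeasF (\<lambda>x. fps_ln 1 oo avg_exp_m1 x)"
  by (intro bmeasF_compose bmeasF_avg_exp_m1)

text \<open>
With \<open>X = E\<^sub>k[exp w - 1]\<close> one has \<open>log (1 + X) - E\<^sub>k[w] = (log (1 + X) - X) + E\<^sub>k[exp w - 1 - w]\<close>, and neither
\<open>log (1 + X) - X\<close> nor \<open>exp w - 1 - w\<close> has a linear term.
\<close>

lemma cgf_minus_avg_eq:
  assumes "x \<in> P"
  shows "cgf k w x - avgF k w x
    = ((fps_ln 1 - fps_X) oo avg_exp_m1 x) + avgF k (\<lambda>x. (fps_exp 1 - 1 - fps_X) oo w x) x"
proof -
  have "avg_exp_m1 x = avgF k (\<lambda>x. (fps_exp 1 - 1 - fps_X) oo w x) x + avgF k w x"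
  proof (rule fps_ext)
    fix r
    have e: "((fps_exp 1 - 1) oo w z) $ r = ((fps_exp 1 - 1 - fps_X) oo w z) $ r + w z $ r"
      if "z \<in> P" for z
      using w0[OF that] by (simp add: fps_compose_sub_distrib fps_X_fps_compose_startby0)
    have "avg_exp_m1 x $ r = avg k (\<lambda>z. ((fps_exp 1 - 1) oo w z) $ r) x"
      by (simp add: avg_exp_m1_def)
    also have "\<dots> = avg k (\<lambda>z. ((fps_exp 1 - 1 - fps_X) oo w z) $ r + w z $ r) x"
      using e by (intro avg_cong assms k)
    also have "\<dots> = (avgF k (\<lambda>x. (fps_exp 1 - 1 - fps_X) oo w x) x + avgF k w x) $ r"
      using assms k w bmeasF_compose by (simp add: avg_add bmeasF_nth)
    finally show "avg_exp_m1 x $ r = (avgF k (\<lambda>x. (fps_exp 1 - 1 - fps_X) oo w x) x + avgF k w x) $ r" .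
  qed
  then show ?thesis
    using avg_exp_m1_0[OF assms] assms
    by (simp add: cgf_eq fps_compose_sub_distrib fps_X_fps_compose_startby0)
qed

lemma idx_J:
  "\<forall>p\<in>trunc_idx J L. fst p \<subseteq> I - {k}" "\<forall>p\<in>trunc_idx_at J L j. fst p \<subseteq> I - {k}"
  using J k by (auto simp: trunc_idx_def trunc_idx_at_def)

text \<open>
The constants are \<open>a / (1 - a)\<close> and \<open>1 / (1 - a)\<close> at \<open>a = 1/12\<close>.
\<close>

lemma avg_exp_m1_bounds:
  "wnorm (trunc_idx J m) avg_exp_m1 \<le> 1 / 11"
  "wnorm (trunc_idx_at J m j) avg_exp_m1 \<le> 12 / 11 * wnorm (trunc_idx_at J m j) w"
proof -
  note comp = wnorm_compose[OF J w w0 fps_exp_coeff_le a]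
  have av: "wnorm Q avg_exp_m1 \<le> wnorm Q (\<lambda>x. (fps_exp 1 - 1) oo w x)" if "\<forall>p\<in>Q. fst p \<subseteq> I - {k}" for Q
    unfolding avg_exp_m1_def using that k w by (intro wnorm_avgF bmeasF_compose) auto
  show "wnorm (trunc_idx J m) avg_exp_m1 \<le> 1 / 11"
    using order_trans[OF av[OF idx_J(1)] comp(1)] by simp
  show "wnorm (trunc_idx_at J m j) avg_exp_m1 \<le> 12 / 11 * wnorm (trunc_idx_at J m j) w"
    using order_trans[OF av[OF idx_J(2)] comp(2)[of j]] by simp
qed

lemma cgf_bound: "wnorm (trunc_idx J m) (cgf k w) \<le> 1 / 10"
proof -
  have "wnorm (trunc_idx J m) (cgf k w) = wnorm (trunc_idx J m) (\<lambda>x. fps_ln 1 oo avg_exp_m1 x)"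
    using trunc_idx_fst_subset[OF J] cgf_eq by (intro wnorm_cong) auto
  then show ?thesis
    using wnorm_compose(1)[OF J bmeasF_avg_exp_m1 avg_exp_m1_0 fps_ln_coeff_le avg_exp_m1_bounds(1)] by simp
qed

text \<open>
The logarithmic part contributes \<open>x^2 / (1 - x) = 1/110\<close> with \<open>x = 1/11\<close>, and the exponential part
\<open>a^2 / (1 - a) = 1/132\<close> with \<open>a = 1/12\<close>. For the terms with \<open>j \<in> V\<close> the factors are
\<open>x / (1 - x) \<cdot> 12/11 = 6/55\<close> and \<open>a / (1 - a) = 1/11\<close>, which add up to \<open>1/5\<close>.
\<close>

lemma cgf_minus_avg_bounds:
  "wnorm (trunc_idx J (Suc m)) (\<lambda>x. cgf k w x - avgF k w x) \<le> 1 / 50"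
  "wnorm (trunc_idx_at J (Suc m) j) (\<lambda>x. cgf k w x - avgF k w x) \<le> wnorm (trunc_idx_at J m j) w / 4"
proof -
  let ?b = "wnorm (trunc_idx_at J m j) w"
  let ?A = "\<lambda>x. (fps_ln 1 - fps_X) oo avg_exp_m1 x" and ?E = "\<lambda>x. (fps_exp 1 - 1 - fps_X) oo w x"
  have c1: "(fps_ln 1 - fps_X :: real fps) $ 1 = 0" "(fps_exp 1 - 1 - fps_X :: real fps) $ 1 = 0"
    by (auto simp: fps_ln_nth)
  have cl: "\<bar>(fps_ln 1 - fps_X :: real fps) $ i\<bar> \<le> 1 / real i" if "i \<ge> 1" for i
    using that by (intro coeff_le_minus_X fps_ln_coeff_le) (auto simp: fps_ln_nth)
  have ce: "\<bar>(fps_exp 1 - 1 - fps_X :: real fps) $ i\<bar> \<le> 1 / real i" if "i \<ge> 1" for i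
    using that by (intro coeff_le_minus_X fps_exp_coeff_le) auto
  note A = wnorm_compose_Suc[OF J bmeasF_avg_exp_m1 avg_exp_m1_0 cl c1(1) avg_exp_m1_bounds(1)]
  note E = wnorm_compose_Suc[OF J w w0 ce c1(2) a]
  have split: "wnorm Q (\<lambda>x. cgf k w x - avgF k w x) \<le> wnorm Q ?A + wnorm Q ?E"
    if Q: "\<forall>p\<in>Q. fst p \<subseteq> I - {k}" for Q
  proof -
    have QI: "\<forall>p\<in>Q. fst p \<subseteq> I" using Q by blast
    have "wnorm Q (\<lambda>x. cgf k w x - avgF k w x) = wnorm Q (\<lambda>x. ?A x + avgF k ?E x)"
      using cgf_minus_avg_eq QI by (intro wnorm_cong) auto
    also have "\<dots> \<le> wnorm Q ?A + wnorm Q (avgF k ?E)"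
      using QI k w bmeasF_avg_exp_m1 by (intro wnorm_add bmeasF_compose bmeasF_avgF) auto
    also have "wnorm Q (avgF k ?E) \<le> wnorm Q ?E"
      using Q k w by (intro wnorm_avgF bmeasF_compose) auto
    finally show ?thesis by simp
  qed
  show "wnorm (trunc_idx J (Suc m)) (\<lambda>x. cgf k w x - avgF k w x) \<le> 1 / 50"
    using split[OF idx_J(1), of "Suc m"] A(1) E(1) by (simp add: power2_eq_square)
  have "0 \<le> ?b" using wnorm_at_nonneg[OF J w] by simp
  moreover have "wnorm (trunc_idx_at J (Suc m) j) ?A \<le> 1 / 10 * (12 / 11 * ?b)"
    using A(2)[of j] avg_exp_m1_bounds(2)[of j] by simp
  moreover have "wnorm (trunc_idx_at J (Suc m) j) ?E \<le> 1 / 11 * ?b"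
    using E(2)[of j] by simp
  ultimately show "wnorm (trunc_idx_at J (Suc m) j) (\<lambda>x. cgf k w x - avgF k w x) \<le> ?b / 4"
    using split[OF idx_J(2), of "Suc m" j] by linarith
qed

text \<open>
If \<open>t < 1\<close>, then \<open>\<epsilon>\<close> exceeds the sum of the trivial bounds on \<open>|l|\<close> and \<open>|log W|\<close>. If \<open>t \<ge> 1\<close>, let \<open>T\<close> be the sum of the coefficients up to order \<open>m\<close> of
\<open>E\<^sub>k[exp w]\<close>, which as a formal series is the exponential of \<open>cgf k w\<close>. Then \<open>exp l\<close> and \<open>W\<close> are both close to \<open>T\<close> by
\<open>exp_truncation_error\<close>, applied to \<open>cgf k w\<close> and pointwise to \<open>w\<close>.
\<close>

lemma cgf_truncation:
  assumes x: "x \<in> P"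
  defines "\<epsilon> \<equiv> 1 / t ^ (m + 1)"
  defines "W \<equiv> avg k (\<lambda>z. exp (\<Sum>r=1..m. w z $ r)) x"
  defines "l \<equiv> (\<Sum>r=1..m. cgf k w x $ r)"
  shows "exp (l - \<epsilon>) \<le> W" and "W \<le> exp (l + \<epsilon>)"
proof -
  have wz: "(\<Sum>r=1..m. \<bar>w z $ r\<bar> * t ^ r) \<le> 1 / 12" if "z \<in> P" for z
    using abs_coeff_sum_le_wnorm[OF w that J, of m] a by simp
  have lz: "(\<Sum>r=1..m. \<bar>cgf k w x $ r\<bar> * t ^ r) \<le> 1 / 10"
  proof -
    have "(\<Sum>r=1..m. \<bar>cgf k w x $ r\<bar> * t ^ r) \<le> wnorm (trunc_idx J m) (\<lambda>x. fps_ln 1 oo avg_exp_m1 x)"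
      using abs_coeff_sum_le_wnorm[OF bmeasF_cgf_P x J, of m] cgf_eq[OF x] by simp
    also have "\<dots> = wnorm (trunc_idx J m) (cgf k w)"
      using trunc_idx_fst_subset[OF J] cgf_eq by (intro wnorm_cong) auto
    finally show ?thesis using cgf_bound by simp
  qed
  have bmw: "bmeas (\<lambda>z. \<Sum>r=1..m. w z $ r)"
    using w by (intro bmeas_sum bmeasF_nth)
  have Wbd: "exp (- c) \<le> W \<and> W \<le> exp c" if "\<And>z. z \<in> P \<Longrightarrow> \<bar>\<Sum>r=1..m. w z $ r\<bar> \<le> c" for c
  proof -
    have "avg k (\<lambda>_. exp (- c)) x \<le> W" "W \<le> avg k (\<lambda>_. exp c) x"
      unfolding W_def using that
      by (intro avg_mono[OF bmeas_const bmeas_exp[OF bmw] x k(1)] avg_mono[OF bmeas_exp[OF bmw] bmeas_const x k(1)];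
          fastforce simp: abs_le_iff)+
    then show ?thesis by simp
  qed
  have "exp (l - \<epsilon>) \<le> W \<and> W \<le> exp (l + \<epsilon>)"
  proof (cases "t \<ge> 1")
    case False
    then have t1: "t < 1" by simp
    \<comment> \<open>the bounds on the exponents of \<open>W\<close> and \<open>exp l\<close> are \<open>1/12\<close> and \<open>1/10\<close>, divided by \<open>t ^ m\<close>\<close>
    have "1 / 12 + 1 / 10 \<le> 1 / t" 
      using t1 t_pos by (simp add: field_simps)
    then have "(1 / 12 + 1 / 10) / t ^ m \<le> 1 / t / t ^ m"
      using t_pos by (intro divide_right_mono) auto
    then have eps: "1 / 12 / t ^ m + 1 / 10 / t ^ m \<le> \<epsilon>"
      by (simp add: \<epsilon>_def add_divide_distrib)
    have l: "\<bar>l\<bar> \<le> 1 / 10 / t ^ m"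
      unfolding l_def by (rule coeff_sum_abs_le_small_t[OF lz t1])
    have "exp (- (1 / 12 / t ^ m)) \<le> W \<and> W \<le> exp (1 / 12 / t ^ m)"
      using coeff_sum_abs_le_small_t[OF wz t1] by (intro Wbd)
    moreover have "exp (l - \<epsilon>) \<le> exp (- (1 / 12 / t ^ m))" "exp (1 / 12 / t ^ m) \<le> exp (l + \<epsilon>)"
      using l eps by auto
    ultimately show ?thesis by linarith
  next
    case True
    define T where "T = (\<Sum>r\<le>m. fps_Exp (cgf k w x) $ r)"
    have q: "1 \<le> t ^ (m + 1)" using True by (rule one_le_power)
    have e1: "exp (1 / 12 :: real) - 1 \<le> 1 / 11" "exp (1 / 10 :: real) - 1 \<le> 1 / 9"
      using exp_ge_add_one_self[of "- (1 / 12) :: real"] exp_ge_add_one_self[of "- (1 / 10) :: real"]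
      by (auto simp: exp_minus field_simps)
    have "\<bar>exp l - T\<bar> \<le> (exp (1 / 10) - 1) / t ^ (m + 1)"
      unfolding l_def T_def by (rule exp_truncation_error[OF True _ lz]) (simp add: cgf_def)
    also have "\<dots> \<le> (1 / 9) / t ^ (m + 1)"
      using e1 q by (intro divide_right_mono) auto
    finally have lT: "\<bar>exp l - T\<bar> \<le> (1 / 9) * \<epsilon>"
      by (simp add: \<epsilon>_def)
    have "T = (\<Sum>r\<le>m. avg k (\<lambda>z. fps_Exp (w z) $ r) x)"
    proof -
      have "fps_Exp (cgf k w x) = avgF k (\<lambda>z. fps_Exp (w z)) x"
        unfolding cgf_def by (rule fps_Exp_Ln) simp
      then show ?thesis by (simp add: T_def)
    qed
    also have "\<dots> = avg k (\<lambda>z. \<Sum>r\<le>m. fps_Exp (w z) $ r) x"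
      using x k w by (intro avg_sum[symmetric]) (auto simp: fps_Exp_def intro!: bmeasF_nth bmeasF_compose)
    finally have "W - T = avg k (\<lambda>z. exp (\<Sum>r=1..m. w z $ r) - (\<Sum>r\<le>m. fps_Exp (w z) $ r)) x"
      unfolding W_def using x k w bmw
      by (subst avg_diff) (auto simp: fps_Exp_def intro!: bmeas_exp bmeas_sum bmeasF_nth bmeasF_compose)
    also have "\<bar>\<dots>\<bar> \<le> (1 / 11) * \<epsilon>"
    proof (rule abs_avg_le)
      show "bmeas (\<lambda>z. exp (\<Sum>r=1..m. w z $ r) - (\<Sum>r\<le>m. fps_Exp (w z) $ r))"
        using w bmw by (auto simp: fps_Exp_def intro!: bmeas_diff bmeas_exp bmeas_sum bmeasF_nth bmeasF_compose)
      fix z assume z: "z \<in> P"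
      have "\<bar>exp (\<Sum>r=1..m. w z $ r) - (\<Sum>r\<le>m. fps_Exp (w z) $ r)\<bar> \<le> (exp (1 / 12) - 1) / t ^ (m + 1)"
        by (rule exp_truncation_error[OF True w0[OF z] wz[OF z]])
      also have "\<dots> \<le> (1 / 11) / t ^ (m + 1)"
        using e1 q by (intro divide_right_mono) auto
      finally show "\<bar>exp (\<Sum>r=1..m. w z $ r) - (\<Sum>r\<le>m. fps_Exp (w z) $ r)\<bar> \<le> (1 / 11) * \<epsilon>"
        by (simp add: \<epsilon>_def)
    qed (use x k in auto)
    finally have WT: "\<bar>W - T\<bar> \<le> (1 / 11) * \<epsilon>" .
    have "0 \<le> \<epsilon>" using q by (simp add: \<epsilon>_def)
    have "\<bar>l\<bar> \<le> 1 / 10"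
      unfolding l_def by (rule coeff_sum_abs_le[OF lz True])
    then have "exp (- (1 / 10)) \<le> exp l" by simp
    moreover have "1 + - (1 / 10) \<le> exp (- (1 / 10) :: real)" by (rule exp_ge_add_one_self)
    ultimately have el: "9 / 10 \<le> exp l" by linarith
    have "exp (- (1 / 12)) \<le> W"
      using coeff_sum_abs_le[OF wz True] Wbd by blast
    moreover have "1 + - (1 / 12) \<le> exp (- (1 / 12) :: real)" by (rule exp_ge_add_one_self)
    ultimately have Wl: "9 / 10 \<le> W" by linarith
    have d: "\<bar>W - exp l\<bar> \<le> (9 / 10) * \<epsilon>"
      using WT lT \<open>0 \<le> \<epsilon>\<close> by linarith
    have "9 / 10 * \<epsilon> \<le> exp l * \<epsilon>" "9 / 10 * \<epsilon> \<le> W * \<epsilon>"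
      using mult_right_mono[OF el \<open>0 \<le> \<epsilon>\<close>] mult_right_mono[OF Wl \<open>0 \<le> \<epsilon>\<close>] by auto
    then have "W \<le> exp l + exp l * \<epsilon>" "exp l \<le> W + W * \<epsilon>"
      using d by linarith+
    then have "W \<le> exp l * (1 + \<epsilon>)" "exp l \<le> W * (1 + \<epsilon>)"
      by (simp_all add: distrib_left)
    moreover have "exp l * (1 + \<epsilon>) \<le> exp l * exp \<epsilon>" "W * (1 + \<epsilon>) \<le> W * exp \<epsilon>"
      using Wl by (auto intro!: mult_left_mono exp_ge_add_one_self)
    ultimately have "W \<le> exp l * exp \<epsilon>" "exp l \<le> W * exp \<epsilon>" by linarith+
    then show ?thesis by (simp add: exp_add exp_diff pos_divide_le_eq)
  qed
  then show "exp (l - \<epsilon>) \<le> W" "W \<le> exp (l + \<epsilon>)" by auto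
qed

end

end

section \<open>Averaging over all coordinates\<close>

context product_law
begin

text \<open>
Resampling a coordinate from its own law preserves the product measure.
\<close>

lemma integral_avg:
  assumes "bmeas g" "k \<in> I"
  shows "(LINT x|PiM I \<mu>. avg k g x) = (LINT x|PiM I \<mu>. g x)"
proof -
  have I: "insert k (I - {k}) = I" using assms by auto
  have int: "integrable (PiM I \<mu>) h" if h: "bmeas h" for h
  proof -
    obtain C where "\<forall>x\<in>P. \<bar>h x\<bar> \<le> C" using bmeas_bound[OF h] by blast
    then show ?thesis
      using bmeas_measurable[OF h] by (intro P.integrable_const_bound[of _ C]) auto
  qed
  have fub: "(LINT x|PiM I \<mu>. h x) = (LINT x|PiM (I - {k}) \<mu>. LINT s|\<mu> k. h (x(k := s)))" if "bmeas h" for h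
    using product_integral_insert[of "I - {k}" k h] int[OF that] I by simp
  show ?thesis
    unfolding fub[OF assms(1)] fub[OF bmeas_avg[OF assms]] by (simp add: avg_def M.prob_space)
qed

primrec iter_avg :: "nat \<Rightarrow> ((nat \<Rightarrow> 'b) \<Rightarrow> real) \<Rightarrow> (nat \<Rightarrow> 'b) \<Rightarrow> real" where
  "iter_avg 0 g = g"
| "iter_avg (Suc k) g = avg (Suc k) (iter_avg k g)"

lemma bmeas_iter_avg:
  assumes "bmeas g" "{1..k} \<subseteq> I"
  shows "bmeas (iter_avg k g)"
  using assms(2)
proof (induction k)
  case (Suc k)
  then have "{1..k} \<subseteq> I" "Suc k \<in> I" by auto
  then show ?case using Suc.IH by (simp add: bmeas_avg)
qed (use assms in simp)

lemma iter_avg_indep: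
  assumes "\<And>i. i \<notin> {1..k} \<Longrightarrow> x i = x' i"
  shows "iter_avg k g x = iter_avg k g x'"
  using assms
proof (induction k arbitrary: x x')
  case 0
  then have "x = x'" by auto
  then show ?case by simp
next
  case (Suc k)
  have "iter_avg k g (x(Suc k := s)) = iter_avg k g (x'(Suc k := s))" for s
    using Suc.prems by (intro Suc.IH) (auto simp: le_Suc_eq)
  then show ?case by (simp add: avg_def)
qed

text \<open>
The iterated average over all coordinates no longer depends on the point, and it has the same
integral as \<open>g\<close>.
\<close>

lemma iter_avg_eq_integral:
  assumes "I = {1..n}" "bmeas g" "x \<in> P"
  shows "iter_avg n g x = (LINT z|PiM I \<mu>. g z)"
proof -
  have "(LINT z|PiM I \<mu>. iter_avg k g z) = (LINT z|PiM I \<mu>. g z)" if "k \<le> n" for k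
    using that
  proof (induction k)
    case (Suc k)
    have "{1..k} \<subseteq> I" "Suc k \<in> I"
      using Suc.prems assms(1) by auto
    moreover from this have "bmeas (iter_avg k g)"
      using assms(2) by (intro bmeas_iter_avg)
    ultimately show ?case
      using Suc by (simp add: integral_avg)
  qed simp
  then have "(LINT z|PiM I \<mu>. g z) = (LINT z|PiM I \<mu>. iter_avg n g z)" by simp
  also have "\<dots> = (LINT z|PiM I \<mu>. iter_avg n g x)"
  proof (rule Bochner_Integration.integral_cong[OF refl])
    fix z assume "z \<in> P"
    then show "iter_avg n g z = iter_avg n g x"
      using assms by (intro iter_avg_indep) (auto simp: space_PiM PiE_def extensional_def)
  qed
  also have "\<dots> = iter_avg n g x" by (simp add: P.prob_space)
  finally show ?thesis by simp
qed

end

text \<open>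
The parameter \<open>t\<close> is kept apart from \<open>1 / (16 \<alpha>)\<close> so that \<open>\<alpha> = 0\<close> is covered by letting \<open>t\<close> grow.
\<close>

locale bounded_differences = weighted_product_law \<mu> I t
  for \<mu> :: "nat \<Rightarrow> 'b measure" and I and t :: real +
  fixes n m :: nat and f :: "(nat \<Rightarrow> 'b) \<Rightarrow> real" and \<alpha> :: real
  assumes I_eq: "I = {1..n}" and m_pos: "m > 0" and bmeas_f: "bmeas f"
    and sum_D: "\<And>v j. v \<in> {1..m} \<Longrightarrow> j \<in> I \<Longrightarrow>
      (\<Sum>V | V \<subseteq> I \<and> card V = v \<and> j \<in> V. D V f) \<le> \<alpha>"
    and t_small: "t * \<alpha> \<le> 1 / 16"
begin

lemma Suc_in_I: "k < n \<Longrightarrow> Suc k \<in> I"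
  by (simp add: I_eq)

text \<open>
\<open>cmgf k\<close> and \<open>ccgf k\<close> are the formal moment and cumulant generating functions of \<open>f\<close> given the
coordinates after \<open>k\<close>; \<open>dcgf k\<close> below is the increment of \<open>ccgf k\<close> in the next coordinate to be averaged.
\<close>

primrec cmgf :: "nat \<Rightarrow> (nat \<Rightarrow> 'b) \<Rightarrow> real fps" where
  "cmgf 0 = (\<lambda>x. fps_exp (f x))"
| "cmgf (Suc k) = avgF (Suc k) (cmgf k)"

definition ccgf :: "nat \<Rightarrow> (nat \<Rightarrow> 'b) \<Rightarrow> real fps" where
  "ccgf k x = fps_Ln (cmgf k x)"

lemma bmeasF_cmgf: "k \<le> n \<Longrightarrow> bmeasF (cmgf k)"
proof (induction k)
  case 0
  show ?case
    using bmeas_mult[OF bmeas_power[OF bmeas_f] bmeas_const] by (simp add: bmeasF_def divide_inverse)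
next
  case (Suc k)
  then show ?case by (auto intro!: bmeasF_avgF Suc_in_I)
qed

lemma cmgf_0 [simp]: "cmgf k x $ 0 = 1"
  by (induction k arbitrary: x) auto

lemma cmgf_nth: "cmgf k x $ r = iter_avg k (\<lambda>z. f z ^ r / fact r) x"
  by (induction k arbitrary: x) auto

lemma bmeasF_ccgf: "k \<le> n \<Longrightarrow> bmeasF (ccgf k)"
  unfolding ccgf_def fps_Ln_def by (intro bmeasF_compose bmeasF_diff bmeasF_const bmeasF_cmgf)

lemma ccgf_0 [simp]: "ccgf k x $ 0 = 0"
  by (simp add: ccgf_def)

lemma ccgf_start: "ccgf 0 x = fps_const (f x) * fps_X"
  by (simp add: ccgf_def fps_exp_eq_Exp fps_Ln_Exp)

definition y\<^sub>0 :: "nat \<Rightarrow> 'b" where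
  "y\<^sub>0 = (SOME y. y \<in> P)"

lemma y0 [simp]: "y\<^sub>0 \<in> P"
  unfolding y\<^sub>0_def using P_nonempty by (metis ex_in_conv someI_ex)

definition dcgf :: "nat \<Rightarrow> (nat \<Rightarrow> 'b) \<Rightarrow> real fps" where
  "dcgf k x = ccgf k x - ccgf k (x(Suc k := y\<^sub>0 (Suc k)))"

lemma bmeasF_dcgf: "k < n \<Longrightarrow> bmeasF (dcgf k)"
  unfolding dcgf_def using bmeasF_ccgf[of k] bmeasF_repl[OF bmeasF_ccgf[of k] y0 Suc_in_I] by (intro bmeasF_diff) auto

lemma dcgf_0 [simp]: "dcgf k x $ 0 = 0"
  by (simp add: dcgf_def)

text \<open>
The value at the base point does not depend on coordinate \<open>Suc k\<close>. Its exponential is therefore a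
constant factor under the average, which the logarithm turns into a summand.
\<close>

lemma ccgf_Suc_base:
  assumes "k < n" "x \<in> P"
  shows "ccgf (Suc k) x = ccgf k (x(Suc k := y\<^sub>0 (Suc k))) + cgf (Suc k) (dcgf k) x"
proof -
  let ?b = "\<lambda>x. x(Suc k := y\<^sub>0 (Suc k))"
  have cmgf: "cmgf k z = fps_Exp (dcgf k z) * cmgf k (?b z)" for z
  proof -
    have "cmgf k z = fps_Exp (dcgf k z + ccgf k (?b z))"
      by (simp add: dcgf_def ccgf_def fps_Exp_Ln)
    also have "\<dots> = fps_Exp (dcgf k z) * cmgf k (?b z)"
      by (simp add: fps_Exp_add ccgf_def fps_Exp_Ln)
    finally show ?thesis .
  qed
  have pull: "avg (Suc k) (\<lambda>z. g z * h (?b z)) x = avg (Suc k) g x * h (?b x)" for g h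
    by (simp add: avg_def)
  have bmE: "bmeas (\<lambda>z. fps_Exp (dcgf k z) $ s)" for s
    unfolding fps_Exp_def using assms by (intro bmeasF_nth bmeasF_compose bmeasF_dcgf)
  have bmb: "bmeas (\<lambda>z. cmgf k (?b z) $ s)" for s
    using assms bmeasF_nth[OF bmeasF_repl[OF bmeasF_cmgf[of k] y0 Suc_in_I]] by simp
  have "cmgf (Suc k) x = avgF (Suc k) (\<lambda>z. fps_Exp (dcgf k z)) x * cmgf k (?b x)"
  proof (rule fps_ext)
    fix r
    have "cmgf (Suc k) x $ r = avg (Suc k) (\<lambda>z. \<Sum>s=0..r. fps_Exp (dcgf k z) $ s * cmgf k (?b z) $ (r - s)) x"
      unfolding cmgf.simps avgF_nth cmgf[THEN arg_cong, of "\<lambda>a. a $ r"] fps_mult_nth ..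
    also have "\<dots> = (\<Sum>s=0..r. avg (Suc k) (\<lambda>z. fps_Exp (dcgf k z) $ s * cmgf k (?b z) $ (r - s)) x)"
      using assms Suc_in_I bmE bmb by (intro avg_sum bmeas_mult) auto
    also have "\<dots> = (avgF (Suc k) (\<lambda>z. fps_Exp (dcgf k z)) x * cmgf k (?b x)) $ r"
    proof -
      have "avg (Suc k) (\<lambda>z. fps_Exp (dcgf k z) $ s * cmgf k (?b z) $ (r - s)) x
          = avg (Suc k) (\<lambda>z. fps_Exp (dcgf k z) $ s) x * cmgf k (?b x) $ (r - s)" for s
        by (rule pull[of "\<lambda>z. fps_Exp (dcgf k z) $ s" "\<lambda>z. cmgf k z $ (r - s)"])
      then show ?thesis by (simp add: fps_mult_nth)
    qed
    finally show "cmgf (Suc k) x $ r = (avgF (Suc k) (\<lambda>z. fps_Exp (dcgf k z)) x * cmgf k (?b x)) $ r" .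
  qed
  then show ?thesis
    by (simp add: ccgf_def cgf_def fps_Ln_mult add.commute del: cmgf.simps)
qed

lemma ccgf_Suc_avg:
  assumes "k < n" "x \<in> P"
  shows "ccgf (Suc k) x = avgF (Suc k) (ccgf k) x + (cgf (Suc k) (dcgf k) x - avgF (Suc k) (dcgf k) x)"
proof -
  let ?b = "\<lambda>x. x(Suc k := y\<^sub>0 (Suc k))"
  have "avgF (Suc k) (dcgf k) x $ r = (avgF (Suc k) (ccgf k) x - ccgf k (?b x)) $ r" for r
  proof -
    have "avgF (Suc k) (dcgf k) x $ r = avg (Suc k) (\<lambda>z. ccgf k z $ r - ccgf k (?b z) $ r) x"
      by (simp add: dcgf_def)
    also have "\<dots> = avg (Suc k) (\<lambda>z. ccgf k z $ r) x - avg (Suc k) (\<lambda>z. ccgf k (?b z) $ r) x"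
      using assms Suc_in_I bmeasF_nth[OF bmeasF_repl[OF bmeasF_ccgf[of k] y0 Suc_in_I]] bmeasF_nth[OF bmeasF_ccgf]
      by (intro avg_diff) auto
    also have "avg (Suc k) (\<lambda>z. ccgf k (?b z) $ r) x = ccgf k (?b x) $ r"
      by (simp add: avg_def M.prob_space)
    finally show ?thesis by simp
  qed
  then have "avgF (Suc k) (dcgf k) x = avgF (Suc k) (ccgf k) x - ccgf k (?b x)"
    by (rule fps_ext)
  then show ?thesis using ccgf_Suc_base[OF assms] by simp
qed

text \<open>
A difference of the increment over \<open>V\<close> is a difference of \<open>ccgf k\<close> over \<open>insert (Suc k) V\<close>; the factor
\<open>4\<close> compensates for the weight of the additional coordinate.
\<close>

lemma wnorm_dcgf_le:
  assumes k: "k < n" and Q: "\<forall>p\<in>Q. fst p \<subseteq> I \<and> Suc k \<notin> fst p" and Q': "finite Q'" "\<forall>p\<in>Q'. fst p \<subseteq> I"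
    and sub: "\<And>V r. (V, r) \<in> Q \<Longrightarrow> (insert (Suc k) V, r) \<in> Q'"
  shows "wnorm Q (dcgf k) \<le> 4 * wnorm Q' (ccgf k)"
proof -
  let ?\<phi> = "\<lambda>(V::nat set, r::nat). (insert (Suc k) V, r)"
  have ccgf: "bmeasF (ccgf k)" using k by (intro bmeasF_ccgf) simp
  have "wnorm Q (dcgf k) \<le> (\<Sum>p\<in>Q. 4 * wt (ccgf k) (?\<phi> p))"
    unfolding wnorm_def
  proof (rule sum_mono)
    fix p assume "p \<in> Q"
    obtain V r where p: "p = (V, r)" by (cases p)
    have V: "V \<subseteq> I" "Suc k \<notin> V" using bspec[OF Q \<open>p \<in> Q\<close>] p by auto
    then have fV: "finite V" using finI finite_subset by blast
    have "D V (\<lambda>x. dcgf k x $ r) = D V (diff_op (Suc k) y\<^sub>0 (\<lambda>x. ccgf k x $ r))"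
      by (simp add: dcgf_def diff_op_def repl_op_def)
    also have "\<dots> \<le> D (insert (Suc k) V) (\<lambda>x. ccgf k x $ r)"
      using V k by (intro D_diff_op bmeasF_nth[OF ccgf] Suc_in_I y0)
    finally have "D V (\<lambda>x. dcgf k x $ r) * ((1 / 4) ^ card V * t ^ r)
        \<le> D (insert (Suc k) V) (\<lambda>x. ccgf k x $ r) * ((1 / 4) ^ card V * t ^ r)"
      using t_pos by (intro mult_right_mono) auto
    then show "wt (dcgf k) p \<le> 4 * wt (ccgf k) (?\<phi> p)"
      using V fV by (simp add: wt_def p)
  qed
  also have "\<dots> = 4 * (\<Sum>p\<in>?\<phi> ` Q. wt (ccgf k) p)"
  proof -
    have "inj_on ?\<phi> Q"
    proof (rule inj_onI)
      fix p q assume pq: "p \<in> Q" "q \<in> Q" "?\<phi> p = ?\<phi> q"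
      then have "insert (Suc k) (fst p) = insert (Suc k) (fst q)" "snd p = snd q"
        by (auto simp: case_prod_beta)
      moreover have "Suc k \<notin> fst p" "Suc k \<notin> fst q" using Q pq by auto
      ultimately show "p = q" by (simp add: prod_eq_iff insert_ident)
    qed
    then show ?thesis by (simp add: sum.reindex sum_distrib_left)
  qed
  also have "(\<Sum>p\<in>?\<phi> ` Q. wt (ccgf k) p) \<le> wnorm Q' (ccgf k)"
    unfolding wnorm_def using Q' sub ccgf by (intro sum_mono2 wt_nonneg) auto
  finally show ?thesis by simp
qed

lemma wnorm_dcgf_K:
  assumes "k < n"
  shows "wnorm (trunc_idx {Suc k<..n} m) (dcgf k) \<le> 4 * wnorm (trunc_idx_at {k<..n} (Suc m) (Suc k)) (ccgf k)"
proof (rule wnorm_dcgf_le[OF assms])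
  show "\<forall>p\<in>trunc_idx {Suc k<..n} m. fst p \<subseteq> I \<and> Suc k \<notin> fst p"
    by (auto simp: trunc_idx_def I_eq subset_iff)
  show "finite (trunc_idx_at {k<..n} (Suc m) (Suc k))"
    by (intro finite_trunc_idx_at) simp
  show "\<forall>p\<in>trunc_idx_at {k<..n} (Suc m) (Suc k). fst p \<subseteq> I"
    by (auto simp: trunc_idx_def trunc_idx_at_def I_eq subset_iff)
  fix V r assume V: "(V, r) \<in> trunc_idx {Suc k<..n} m"
  then have "card (insert (Suc k) V) \<le> Suc (card V)"
    by (intro card_insert_le_m1) auto
  then show "(insert (Suc k) V, r) \<in> trunc_idx_at {k<..n} (Suc m) (Suc k)"
    using V assms by (auto simp: trunc_idx_def trunc_idx_at_def subset_iff)
qed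

lemma wnorm_dcgf_at:
  assumes "k < n"
  shows "wnorm (trunc_idx_at {Suc k<..n} m j) (dcgf k)
    \<le> 4 * wnorm {p \<in> trunc_idx_at {k<..n} (Suc m) j. Suc k \<in> fst p} (ccgf k)"
proof (rule wnorm_dcgf_le[OF assms])
  show "\<forall>p\<in>trunc_idx_at {Suc k<..n} m j. fst p \<subseteq> I \<and> Suc k \<notin> fst p"
    by (auto simp: trunc_idx_def trunc_idx_at_def I_eq subset_iff)
  show "finite {p \<in> trunc_idx_at {k<..n} (Suc m) j. Suc k \<in> fst p}"
    using finite_trunc_idx_at[of "{k<..n}" "Suc m" j] by simp
  show "\<forall>p\<in>{p \<in> trunc_idx_at {k<..n} (Suc m) j. Suc k \<in> fst p}. fst p \<subseteq> I"
    by (auto simp: trunc_idx_def trunc_idx_at_def I_eq subset_iff)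
  fix V r assume V: "(V, r) \<in> trunc_idx_at {Suc k<..n} m j"
  then have "card (insert (Suc k) V) \<le> Suc (card V)"
    by (intro card_insert_le_m1) auto
  then show "(insert (Suc k) V, r) \<in> {p \<in> trunc_idx_at {k<..n} (Suc m) j. Suc k \<in> fst p}"
    using V assms by (auto simp: trunc_idx_def trunc_idx_at_def subset_iff)
qed

text \<open>
Only the coefficient of order one is present. By the hypothesis the sets of size \<open>v\<close> contribute at
most \<open>t \<alpha> / 4^v\<close>, and the geometric series adds up to \<open>t \<alpha> / 3\<close>.
\<close>

lemma wnorm_ccgf_start:
  assumes j: "j \<in> I"
  shows "wnorm (trunc_idx_at {0<..n} (Suc m) j) (ccgf 0) \<le> 1 / 48"
proof -
  let ?S = "\<lambda>v. {V. V \<subseteq> I \<and> card V = v \<and> j \<in> V}"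
  let ?h = "\<lambda>V. D V f * (1 / 4) ^ card V * t"
  have I0: "{0<..n} = I" by (auto simp: I_eq)
  have finS: "finite (?S v)" for v by (rule finite_subset[of _ "Pow I"]) auto
  let ?Q = "(\<lambda>V. (V, 1::nat)) ` (\<Union>v\<in>{1..m}. ?S v)"
  have "wnorm (trunc_idx_at {0<..n} (Suc m) j) (ccgf 0) = wnorm ?Q (ccgf 0)"
    unfolding wnorm_def
  proof (rule sum.mono_neutral_right)
    show "finite (trunc_idx_at {0<..n} (Suc m) j)" by (intro finite_trunc_idx_at) simp
    show "?Q \<subseteq> trunc_idx_at {0<..n} (Suc m) j"
      unfolding I0 by (auto simp: trunc_idx_at_def trunc_idx_def)
    show "\<forall>p\<in>trunc_idx_at {0<..n} (Suc m) j - ?Q. wt (ccgf 0) p = 0"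
    proof
      fix p assume p: "p \<in> trunc_idx_at {0<..n} (Suc m) j - ?Q"
      obtain V r where pe: "p = (V, r)" by (cases p)
      have V: "V \<subseteq> I" "j \<in> V" "card V + r \<le> Suc m" "1 \<le> r"
        using p pe I0 by (auto simp: trunc_idx_at_def trunc_idx_def)
      then have "1 \<le> card V" using finI finite_subset[of V I] by (auto simp: Suc_le_eq card_gt_0_iff)
      then have "r \<noteq> 1" using p pe V by (auto simp: image_iff)
      then have "(\<lambda>x. ccgf 0 x $ r) = (\<lambda>x. 0)" by (auto simp: ccgf_start)
      then show "wt (ccgf 0) p = 0" using V by (simp add: wt_def pe)
    qed
  qed
  also have "\<dots> = (\<Sum>V\<in>(\<Union>v\<in>{1..m}. ?S v). ?h V)"
    unfolding wnorm_def by (subst sum.reindex) (auto simp: inj_on_def wt_def ccgf_start)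
  also have "\<dots> = (\<Sum>v=1..m. \<Sum>V\<in>?S v. ?h V)"
    using finS by (intro sum.UNION_disjoint) auto
  also have "\<dots> \<le> (\<Sum>v=1..m. 1 / 64 * (1 / 4) ^ (v - 1))"
  proof (rule sum_mono)
    fix v assume v: "v \<in> {1..m}"
    have "(\<Sum>V\<in>?S v. ?h V) = (\<Sum>V\<in>?S v. D V f) * ((1 / 4) ^ v * t)"
      unfolding sum_distrib_right by (intro sum.cong) auto
    also have "\<dots> \<le> \<alpha> * ((1 / 4) ^ v * t)"
      using sum_D[OF v j] t_pos by (intro mult_right_mono) auto
    also have "\<dots> = t * \<alpha> * (1 / 4) ^ v" by simp
    also have "\<dots> \<le> 1 / 16 * (1 / 4) ^ v" 
      using t_small by (intro mult_right_mono) auto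
    also have "\<dots> = 1 / 64 * (1 / 4) ^ (v - 1)"
      using v by (simp add: power_eq_if)
    finally show "(\<Sum>V\<in>?S v. ?h V) \<le> 1 / 64 * (1 / 4) ^ (v - 1)" .
  qed
  also have "\<dots> = 1 / 64 * (\<Sum>v=1..m. (1 / 4) ^ (v - 1))" 
    by (simp only: sum_distrib_left)
  also have "\<dots> \<le> 1 / 64 * (1 / (1 - 1 / 4))"
    by (intro mult_left_mono sum_power_from_1_le) auto
  finally show ?thesis by simp
qed

lemma J_facts:
  assumes "k < n"
  shows "Suc k \<in> I" "Suc k \<notin> {Suc k<..n}" "{Suc k<..n} \<subseteq> I"
  using assms by (auto simp: I_eq)

text \<open>
The bound is preserved by every step. Of the terms with \<open>j \<in> V\<close>, those with \<open>Suc k \<notin> V\<close> survive the averaging, and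
those with \<open>Suc k \<in> V\<close> pay for the second-order correction: it is at most a quarter of the norm of
the increment, which is at most four times these terms.
\<close>

lemma wnorm_ccgf:
  assumes "k \<le> n" "j \<in> {k<..n}"
  shows "wnorm (trunc_idx_at {k<..n} (Suc m) j) (ccgf k) \<le> 1 / 48"
  using assms
proof (induction k arbitrary: j)
  case 0
  then show ?case using wnorm_ccgf_start[of j] by (simp add: I_eq)
next
  case (Suc k)
  then have k: "k < n" by simp
  let ?J = "{Suc k<..n}" and ?Y = "\<lambda>x. cgf (Suc k) (dcgf k) x - avgF (Suc k) (dcgf k) x"
  let ?Q = "trunc_idx_at {k<..n} (Suc m) j"
  note J = J_facts[OF k]
  have ccgf: "bmeasF (ccgf k)" using k by (intro bmeasF_ccgf) simp
  have a: "wnorm (trunc_idx ?J m) (dcgf k) \<le> 1 / 12"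
    using wnorm_dcgf_K[OF k] Suc.IH[of "Suc k"] Suc.prems by simp
  have Q'I: "\<forall>p\<in>trunc_idx_at ?J (Suc m) j. fst p \<subseteq> I"
    using trunc_idx_at_fst_subset[OF J(3)] by blast
  have "wnorm (trunc_idx_at ?J (Suc m) j) (ccgf (Suc k))
      = wnorm (trunc_idx_at ?J (Suc m) j) (\<lambda>x. avgF (Suc k) (ccgf k) x + ?Y x)"
    using Q'I ccgf_Suc_avg[OF k] by (intro wnorm_cong) auto
  also have "\<dots> \<le> wnorm (trunc_idx_at ?J (Suc m) j) (avgF (Suc k) (ccgf k)) + wnorm (trunc_idx_at ?J (Suc m) j) ?Y"
    using J ccgf Q'I k by (intro wnorm_add bmeasF_diff bmeasF_avgF bmeasF_cgf bmeasF_dcgf) auto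
  also have "wnorm (trunc_idx_at ?J (Suc m) j) (avgF (Suc k) (ccgf k)) \<le> wnorm (trunc_idx_at ?J (Suc m) j) (ccgf k)"
    using J ccgf by (intro wnorm_avgF) (auto simp: trunc_idx_at_def trunc_idx_def I_eq subset_iff)
  also have "wnorm (trunc_idx_at ?J (Suc m) j) ?Y \<le> wnorm (trunc_idx_at ?J m j) (dcgf k) / 4"
    by (rule cgf_minus_avg_bounds(2)[OF J(1,2,3) bmeasF_dcgf[OF k] dcgf_0 a])
  also have "\<dots> \<le> wnorm {p \<in> ?Q. Suc k \<in> fst p} (ccgf k)"
    using wnorm_dcgf_at[OF k, of j] by simp
  also have "wnorm (trunc_idx_at ?J (Suc m) j) (ccgf k) + wnorm {p \<in> ?Q. Suc k \<in> fst p} (ccgf k)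
      = wnorm (trunc_idx_at ?J (Suc m) j \<union> {p \<in> ?Q. Suc k \<in> fst p}) (ccgf k)"
    unfolding wnorm_def
  proof (rule sum.union_disjoint[symmetric])
    show "finite (trunc_idx_at ?J (Suc m) j)" "finite {p \<in> ?Q. Suc k \<in> fst p}"
      using finite_trunc_idx_at[of "{k<..n}" "Suc m" j] by (auto intro: finite_trunc_idx_at)
  qed (auto simp: trunc_idx_at_def trunc_idx_def)
  also have "\<dots> \<le> wnorm ?Q (ccgf k)"
    using ccgf finite_trunc_idx_at[of "{k<..n}" "Suc m" j]
    by (intro wnorm_mono_set) (auto simp: trunc_idx_at_def trunc_idx_def I_eq subset_iff)
  also have "\<dots> \<le> 1 / 48"
    using Suc by simp
  finally show ?case by simp
qed

lemma wnorm_dcgf: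
  assumes "k < n"
  shows "wnorm (trunc_idx {Suc k<..n} m) (dcgf k) \<le> 1 / 12"
  using wnorm_dcgf_K[OF assms] wnorm_ccgf[of k "Suc k"] assms by simp

text \<open>
Averaging does not increase the supremum of a coefficient, so only the second-order corrections add
to it. Order one is excluded because there \<open>ccgf 0\<close> starts with \<open>f\<close> itself.
\<close>

lemma ccgf_coeff_bound:
  assumes "k \<le> n" "x \<in> P" "2 \<le> r" "r \<le> m"
  shows "\<bar>ccgf k x $ r\<bar> * t ^ r \<le> real k / 50"
  using assms(1,2)
proof (induction k arbitrary: x)
  case 0
  then show ?case using assms by (simp add: ccgf_start)
next
  case (Suc k)
  then have k: "k < n" by simp
  let ?J = "{Suc k<..n}" and ?Y = "\<lambda>x. cgf (Suc k) (dcgf k) x - avgF (Suc k) (dcgf k) x"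
  note J = J_facts[OF k]
  have ccgf: "bmeasF (ccgf k)" and Y: "bmeasF ?Y"
    using k J by (auto intro!: bmeasF_ccgf bmeasF_diff bmeasF_cgf bmeasF_avgF bmeasF_dcgf)
  have "\<bar>?Y x $ r\<bar> * t ^ r \<le> (\<Sum>r=1..Suc m. \<bar>?Y x $ r\<bar> * t ^ r)"
    using assms t_pos by (intro member_le_sum) auto
  also have "\<dots> \<le> wnorm (trunc_idx ?J (Suc m)) ?Y"
    by (rule abs_coeff_sum_le_wnorm[OF Y Suc.prems(2) J(3)])
  also have "\<dots> \<le> 1 / 50"
    by (rule cgf_minus_avg_bounds(1)[OF J(1,2,3) bmeasF_dcgf[OF k] dcgf_0 wnorm_dcgf[OF k]])
  finally have Yr: "\<bar>?Y x $ r\<bar> * t ^ r \<le> 1 / 50" .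
  have "\<bar>ccgf k z $ r\<bar> \<le> real k / 50 / t ^ r" if "z \<in> P" for z
    using Suc.IH[OF _ that] k t_pos by (simp add: pos_le_divide_eq)
  then have "\<bar>avg (Suc k) (\<lambda>z. ccgf k z $ r) x\<bar> \<le> real k / 50 / t ^ r"
    using J Suc.prems by (intro abs_avg_le bmeasF_nth[OF ccgf]) auto
  then have Ar: "\<bar>avg (Suc k) (\<lambda>z. ccgf k z $ r) x\<bar> * t ^ r \<le> real k / 50"
    using t_pos by (simp add: pos_le_divide_eq)
  have "ccgf (Suc k) x $ r = avg (Suc k) (\<lambda>z. ccgf k z $ r) x + ?Y x $ r"
    using ccgf_Suc_avg[OF k Suc.prems(2)] by simp
  then have "\<bar>ccgf (Suc k) x $ r\<bar> * t ^ r \<le> (\<bar>avg (Suc k) (\<lambda>z. ccgf k z $ r) x\<bar> + \<bar>?Y x $ r\<bar>) * t ^ r"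
    using t_pos by (intro mult_right_mono) auto
  then show ?case
    using Yr Ar by (simp add: distrib_right add_divide_distrib)
qed

definition poly_ccgf :: "nat \<Rightarrow> (nat \<Rightarrow> 'b) \<Rightarrow> real" where
  "poly_ccgf k x = (\<Sum>r=1..m. ccgf k x $ r)"

lemma poly_ccgf_0: "poly_ccgf 0 x = f x"
proof -
  have "poly_ccgf 0 x = (\<Sum>r\<in>{1}. ccgf 0 x $ r)"
    unfolding poly_ccgf_def using m_pos by (intro sum.mono_neutral_right) (auto simp: ccgf_start)
  then show ?thesis by (simp add: ccgf_start)
qed

lemma bmeas_poly_ccgf: "k \<le> n \<Longrightarrow> bmeas (poly_ccgf k)"
  unfolding poly_ccgf_def by (intro bmeas_sum bmeasF_nth bmeasF_ccgf)

text \<open>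
Averages are monotone and constants factor out of the exponential, so the relative errors of the
single steps accumulate additively in the exponent.
\<close>

lemma iter_avg_exp_bounds:
  assumes "k \<le> n" "x \<in> P"
  defines "\<epsilon> \<equiv> 1 / t ^ (m + 1)"
  shows "exp (poly_ccgf k x - real k * \<epsilon>) \<le> iter_avg k (\<lambda>z. exp (f z)) x
    \<and> iter_avg k (\<lambda>z. exp (f z)) x \<le> exp (poly_ccgf k x + real k * \<epsilon>)"
  using assms(1,2)
proof (induction k arbitrary: x)
  case 0
  then show ?case by (simp add: poly_ccgf_0)
next
  case (Suc k)
  then have k: "k < n" by simp
  let ?b = "\<lambda>x. x(Suc k := y\<^sub>0 (Suc k))"
  let ?G = "iter_avg k (\<lambda>z. exp (f z))"
  let ?W = "avg (Suc k) (\<lambda>z. exp (\<Sum>r=1..m. dcgf k z $ r)) x"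
  let ?l = "\<Sum>r=1..m. cgf (Suc k) (dcgf k) x $ r"
  note J = J_facts[OF k]
  note tr = cgf_truncation[OF J(1,2,3) bmeasF_dcgf[OF k] dcgf_0 wnorm_dcgf[OF k] Suc.prems(2), folded \<epsilon>_def]
  have bmG: "bmeas ?G" using k by (intro bmeas_iter_avg bmeas_exp bmeas_f) (auto simp: I_eq)
  have bmc: "bmeas (\<lambda>z. exp (poly_ccgf k z + c))" for c
    using k by (intro bmeas_exp bmeas_add bmeas_poly_ccgf bmeas_const) simp
  have shift: "avg (Suc k) (\<lambda>z. exp (poly_ccgf k z + c)) x = exp (poly_ccgf k (?b x) + c) * ?W" for c
  proof -
    have "exp (poly_ccgf k z + c) = exp (poly_ccgf k (?b z) + c) * exp (\<Sum>r=1..m. dcgf k z $ r)" for z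
      by (simp add: poly_ccgf_def dcgf_def sum_subtractf flip: exp_add)
    then have "(\<lambda>z. exp (poly_ccgf k z + c))
        = (\<lambda>z. exp (poly_ccgf k (?b z) + c) * exp (\<Sum>r=1..m. dcgf k z $ r))"
      by (rule ext)
    then show ?thesis by (simp only:) (simp add: avg_def)
  qed
  have tU: "poly_ccgf (Suc k) x = poly_ccgf k (?b x) + ?l"
    using ccgf_Suc_base[OF k Suc.prems(2)] by (simp add: poly_ccgf_def sum.distrib)
  have IH: "exp (poly_ccgf k z + - (real k * \<epsilon>)) \<le> ?G z" "?G z \<le> exp (poly_ccgf k z + real k * \<epsilon>)"
    if "z \<in> P" for z
    using Suc.IH[OF _ that] k by auto
  have "exp (poly_ccgf (Suc k) x - real (Suc k) * \<epsilon>) = exp (poly_ccgf k (?b x) + - (real k * \<epsilon>)) * exp (?l - \<epsilon>)"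
    unfolding tU exp_add[symmetric] by (rule arg_cong[where f = exp]) (simp add: algebra_simps)
  also have "\<dots> \<le> exp (poly_ccgf k (?b x) + - (real k * \<epsilon>)) * ?W"
    using tr(1) by (intro mult_left_mono) auto
  also have "\<dots> \<le> avg (Suc k) ?G x"
    unfolding shift[symmetric] by (rule avg_mono[OF bmc bmG Suc.prems(2) J(1) IH(1)])
  finally have lo: "exp (poly_ccgf (Suc k) x - real (Suc k) * \<epsilon>) \<le> avg (Suc k) ?G x" .
  have "avg (Suc k) ?G x \<le> exp (poly_ccgf k (?b x) + real k * \<epsilon>) * ?W"
    unfolding shift[symmetric] by (rule avg_mono[OF bmG bmc Suc.prems(2) J(1) IH(2)])
  also have "\<dots> \<le> exp (poly_ccgf k (?b x) + real k * \<epsilon>) * exp (?l + \<epsilon>)"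
    using tr(2) by (intro mult_left_mono) auto
  also have "\<dots> = exp (poly_ccgf (Suc k) x + real (Suc k) * \<epsilon>)"
    unfolding tU exp_add[symmetric] by (rule arg_cong[where f = exp]) (simp add: algebra_simps)
  finally show ?case using lo by simp
qed

lemma ccgf_n_eq:
  assumes "x \<in> P"
  shows "ccgf n x = fps_Ln (Abs_fps (\<lambda>r. (LINT z|PiM I \<mu>. f z ^ r) / fact r))"
proof -
  have "cmgf n x = Abs_fps (\<lambda>r. (LINT z|PiM I \<mu>. f z ^ r) / fact r)"
  proof (rule fps_ext)
    fix r
    have "bmeas (\<lambda>z. f z ^ r / fact r)"
      using bmeas_mult[OF bmeas_power[OF bmeas_f] bmeas_const] by (simp add: divide_inverse)
    then show "cmgf n x $ r = Abs_fps (\<lambda>r. (LINT z|PiM I \<mu>. f z ^ r) / fact r) $ r"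
      by (simp add: cmgf_nth iter_avg_eq_integral[OF I_eq _ assms])
  qed
  then show ?thesis by (simp add: ccgf_def)
qed

theorem cumulant_expansion:
  defines "K \<equiv> fps_Ln (Abs_fps (\<lambda>r. (LINT z|PiM I \<mu>. f z ^ r) / fact r))"
    and "E \<equiv> (LINT z|PiM I \<mu>. exp (f z))"
  shows "2 \<le> r \<Longrightarrow> r \<le> m \<Longrightarrow> \<bar>K $ r\<bar> * t ^ r \<le> real n / 50"
    and "exp ((\<Sum>r=1..m. K $ r) - real n / t ^ (m + 1)) \<le> E"
    and "E \<le> exp ((\<Sum>r=1..m. K $ r) + real n / t ^ (m + 1))"
proof -
  have K: "K = ccgf n y\<^sub>0" by (simp add: K_def ccgf_n_eq)
  have E: "E = iter_avg n (\<lambda>z. exp (f z)) y\<^sub>0"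
    unfolding E_def by (rule iter_avg_eq_integral[OF I_eq bmeas_exp[OF bmeas_f] y0, symmetric])
  show "2 \<le> r \<Longrightarrow> r \<le> m \<Longrightarrow> \<bar>K $ r\<bar> * t ^ r \<le> real n / 50"
    unfolding K by (rule ccgf_coeff_bound) auto
  show "exp ((\<Sum>r=1..m. K $ r) - real n / t ^ (m + 1)) \<le> E"
    "E \<le> exp ((\<Sum>r=1..m. K $ r) + real n / t ^ (m + 1))"
    using iter_avg_exp_bounds[OF order_refl y0] by (simp_all add: K E poly_ccgf_def)
qed

end

section \<open>The expansion for independent random variables\<close>

lemma square_le_5_power: "real r ^ 2 \<le> 5 ^ r"
proof (induction r)
  case (Suc r)
  have "real (Suc r) ^ 2 \<le> max 1 (5 * real r ^ 2)"
  proof (cases r)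
    case (Suc s)
    have "1 * 1 \<le> real r * real r" "1 * real r \<le> real r * real r"
      using Suc by (intro mult_mono; simp)+
    then have "real (Suc r) ^ 2 \<le> 5 * real r ^ 2"
      by (simp add: power2_eq_square algebra_simps)
    then show ?thesis by simp
  qed simp
  also have "\<dots> \<le> 5 ^ Suc r"
    using Suc one_le_power[of "5 :: real" "Suc r"] by simp
  finally show ?case .
qed simp

text \<open>
Handles \<open>\<alpha> = 0\<close>, for which no largest \<open>t\<close> with \<open>t \<alpha> \<le> 1/16\<close> exists.
\<close>

lemma le_limit_power:
  fixes \<alpha> C q :: real
  assumes "\<And>\<epsilon>. \<epsilon> > 0 \<Longrightarrow> q \<le> C * (16 * (\<alpha> + \<epsilon>)) ^ r"
  shows "q \<le> C * (16 * \<alpha>) ^ r"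
proof (rule tendsto_lowerbound)
  show "((\<lambda>\<epsilon>. C * (16 * (\<alpha> + \<epsilon>)) ^ r) \<longlongrightarrow> C * (16 * \<alpha>) ^ r) (at_right 0)"
    by (auto intro!: tendsto_eq_intros)
  show "\<forall>\<^sub>F \<epsilon> in at_right 0. q \<le> C * (16 * (\<alpha> + \<epsilon>)) ^ r"
    using assms by (auto simp: eventually_at_right_field intro: exI[of _ 1])
qed simp

lemma abs_exp_minus_1_le:
  fixes x :: real
  assumes "\<bar>x\<bar> \<le> b" shows "\<bar>exp x - 1\<bar> \<le> exp b - 1"
proof -
  have "exp x \<le> exp b" using assms by simp
  moreover have "exp (- x) \<le> exp b" using assms by simp
  moreover have "1 + x \<le> exp x" "1 + (- x) \<le> exp (- x)" by (rule exp_ge_add_one_self)+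
  ultimately show ?thesis by linarith
qed

theorem theorem3p1:
  fixes M :: "'a measure" and S :: "nat \<Rightarrow> 'b measure" and X :: "nat \<Rightarrow> 'a \<Rightarrow> 'b"
    and f :: "(nat \<Rightarrow> 'b) \<Rightarrow> real" and n m :: nat and \<alpha> :: real
  assumes "prob_space M"
    and "n \<ge> 1"
    and "prob_space.indep_vars M S X {1..n}"
    and "m > 0"
    and "\<alpha> \<ge> 0"
    and "f \<in> borel_measurable (PiM {1..n} S)"
    and "bounded (f ` space (PiM {1..n} S))"
    and "(MAX (v, j) \<in> {1..m} \<times> {1..n}.
            \<Sum>V | V \<subseteq> {1..n} \<and> card V = v \<and> j \<in> V. Delta (space (PiM {1..n} S)) V f) \<le> \<alpha>"
  defines "fX \<equiv> (\<lambda>\<omega>. f (\<lambda>i\<in>{1..n}. X i \<omega>))"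
  shows "(\<exists>\<delta>::real. \<delta> > -1 \<and> \<bar>\<delta>\<bar> \<le> exp ((100 * \<alpha>) ^ (m + 1)) - 1 \<and>
            (LINT \<omega>|M. exp (fX \<omega>)) =
              (1 + \<delta>) ^ n * exp (\<Sum>r = 1..m. cumulant M fX r / fact r))
       \<and> (\<forall>r\<in>{2..m}. \<bar>cumulant M fX r\<bar>
            \<le> real n * (fact (r - 1) / (50 * real r)) * (80 * \<alpha>) ^ r)"
proof -
  define I where "I = {1..n}"
  interpret M: prob_space M by fact
  have I: "I \<noteq> {}" using assms(2) by (simp add: I_def)
  have rv: "X i \<in> M \<rightarrow>\<^sub>M S i" if "i \<in> I" for i
    using assms(3) that by (simp add: M.indep_vars_def2 I_def)
  \<comment> \<open>outside of \<open>I\<close> any probability measure will do; the product over \<open>I\<close> does not see it\<close>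
  define \<mu> where "\<mu> i = (if i \<in> I then distr M (S i) (X i) else return (count_space UNIV) undefined)" for i
  have prob_\<mu>: "prob_space (\<mu> i)" for i
    by (auto simp: \<mu>_def rv intro!: M.prob_space_distr prob_space_return)
  have law: "distr M (PiM I S) (\<lambda>\<omega>. \<lambda>i\<in>I. X i \<omega>) = PiM I \<mu>"
  proof -
    have "distr M (PiM I S) (\<lambda>\<omega>. \<lambda>i\<in>I. X i \<omega>) = PiM I (\<lambda>i. distr M (S i) (X i))"
      using M.indep_vars_iff_distr_eq_PiM'[OF I rv] assms(3) by (simp add: I_def)
    also have "\<dots> = PiM I \<mu>" by (intro PiM_cong) (auto simp: \<mu>_def)
    finally show ?thesis .
  qed
  have sets_eq: "sets (PiM I \<mu>) = sets (PiM I S)"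
    unfolding law[symmetric] by simp
  then have space_eq: "space (PiM I \<mu>) = space (PiM I S)"
    by (rule sets_eq_imp_space_eq)
  have XI: "(\<lambda>\<omega>. \<lambda>i\<in>I. X i \<omega>) \<in> M \<rightarrow>\<^sub>M PiM I S"
    using rv by (intro measurable_restrict)
  have fm: "f \<in> borel_measurable (PiM I S)" using assms(6) by (simp add: I_def)
  have push: "(LINT z|PiM I \<mu>. g (f z)) = (LINT \<omega>|M. g (fX \<omega>))" if "g \<in> borel_measurable borel" for g :: "real \<Rightarrow> real"
    unfolding law[symmetric] using XI fm that
    by (subst integral_distr) (auto simp: fX_def I_def)
  have law_locale: "product_law \<mu> I"
    unfolding product_law_def finite_product_prob_space_def finite_product_sigma_finite_def
      product_prob_space_def product_sigma_finite_def finite_product_sigma_finite_axioms_def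
      product_prob_space_axioms_def
    using prob_\<mu> by (auto simp: I_def prob_space_imp_sigma_finite)
  interpret L: product_law \<mu> I by (rule law_locale)
  have bmf: "L.bmeas f"
    using assms(6,7) unfolding L.bmeas_def space_eq measurable_cong_sets[OF sets_eq refl] by (simp add: I_def)
  have D: "(\<Sum>V | V \<subseteq> I \<and> card V = v \<and> j \<in> V. Delta (space (PiM I \<mu>)) V f) \<le> \<alpha>"
    if "v \<in> {1..m}" "j \<in> I" for v j
  proof -
    let ?s = "\<lambda>(v, j). \<Sum>V | V \<subseteq> {1..n} \<and> card V = v \<and> j \<in> V. Delta (space (PiM {1..n} S)) V f"
    have "?s (v, j) \<le> Max (?s ` ({1..m} \<times> {1..n}))"
      using that by (intro Max_ge finite_imageI imageI) (auto simp: I_def)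
    then show ?thesis using assms(8) by (simp add: space_eq) (simp add: I_def)
  qed
  define K where "K r = cumulant M fX r / fact r" for r
  define E where "E = (LINT \<omega>|M. exp (fX \<omega>))"
  have K: "fps_Ln (Abs_fps (\<lambda>r. (LINT z|PiM I \<mu>. f z ^ r) / fact r)) $ r = K r" for r
    by (simp add: K_def cumulant_def mgf_fps_def fps_Ln_def push[of "\<lambda>u. u ^ _"])
  have E: "(LINT z|PiM I \<mu>. exp (f z)) = E"
    by (simp add: E_def push[of exp])
  \<comment> \<open>\<open>t = 1 / (16 (\<alpha> + \<epsilon>))\<close> is admissible and positive even if \<open>\<alpha> = 0\<close>\<close>
  have main: "(2 \<le> r \<longrightarrow> r \<le> m \<longrightarrow> \<bar>K r\<bar> \<le> real n / 50 * (16 * (\<alpha> + \<epsilon>)) ^ r)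
      \<and> exp ((\<Sum>r=1..m. K r) - real n * (16 * (\<alpha> + \<epsilon>)) ^ (m + 1)) \<le> E
      \<and> E \<le> exp ((\<Sum>r=1..m. K r) + real n * (16 * (\<alpha> + \<epsilon>)) ^ (m + 1))"
    if \<epsilon>: "\<epsilon> > 0" for \<epsilon> r
  proof -
    define t where "t = 1 / (16 * (\<alpha> + \<epsilon>))"
    have t: "t > 0" using assms(5) \<epsilon> by (simp add: t_def)
    have inv: "1 / t ^ s = (16 * (\<alpha> + \<epsilon>)) ^ s" for s
      by (simp add: t_def power_one_over)
    have "t * \<alpha> \<le> 1 / 16" using assms(5) \<epsilon> by (simp add: t_def field_simps)
    then interpret B: bounded_differences \<mu> I t n m f \<alpha>
      using t bmf D assms(4) by unfold_locales (auto simp: I_def)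
    note exps = B.cumulant_expansion[unfolded K E]
    have scale: "real n / t ^ s = real n * (16 * (\<alpha> + \<epsilon>)) ^ s" for s
      unfolding inv[symmetric] by simp
    have "\<bar>K r\<bar> \<le> real n / 50 * (16 * (\<alpha> + \<epsilon>)) ^ r" if "2 \<le> r" "r \<le> m"
    proof -
      have "\<bar>K r\<bar> \<le> real n / 50 / t ^ r"
        using exps(1)[OF that] t by (simp only: pos_le_divide_eq zero_less_power)
      also have "\<dots> = real n / 50 * (16 * (\<alpha> + \<epsilon>)) ^ r"
        unfolding inv[symmetric] by simp
      finally show ?thesis .
    qed
    then show ?thesis
      using exps(2,3) unfolding scale by blast
  qed
  have Kbound: "\<bar>K r\<bar> \<le> real n / 50 * (16 * \<alpha>) ^ r" if "2 \<le> r" "r \<le> m" for r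
    by (rule le_limit_power) (use main that in blast)
  note lo = main[THEN conjunct2, THEN conjunct1] and up = main[THEN conjunct2, THEN conjunct2]
  have Epos: "0 < E"
    by (rule less_le_trans[OF exp_gt_zero lo[OF zero_less_one]])
  define A where "A = ln E - (\<Sum>r=1..m. K r)"
  have Aeps: "\<bar>A\<bar> \<le> real n * (16 * (\<alpha> + \<epsilon>)) ^ (m + 1)" if "\<epsilon> > 0" for \<epsilon>
  proof -
    let ?B = "real n * (16 * (\<alpha> + \<epsilon>)) ^ (m + 1)"
    have "(\<Sum>r=1..m. K r) - ?B \<le> ln E"
      using lo[OF that] Epos by (simp only: ln_ge_iff)
    moreover have "ln E \<le> ln (exp ((\<Sum>r=1..m. K r) + ?B))"
      using up[OF that] Epos by (simp only: ln_le_cancel_iff exp_gt_zero)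
    then have "ln E \<le> (\<Sum>r=1..m. K r) + ?B"
      by (simp only: ln_exp)
    ultimately show ?thesis unfolding A_def by linarith
  qed
  have "\<bar>A\<bar> \<le> real n * (16 * \<alpha>) ^ (m + 1)"
    using Aeps by (rule le_limit_power)
  also have "\<dots> \<le> real n * (100 * \<alpha>) ^ (m + 1)"
    using assms(5) by (intro mult_left_mono power_mono) auto
  finally have "\<bar>A\<bar> \<le> real n * (100 * \<alpha>) ^ (m + 1)" .
  then have An: "\<bar>A / real n\<bar> \<le> (100 * \<alpha>) ^ (m + 1)"
    using assms(2) by (simp add: field_simps)
  \<comment> \<open>the only choice of \<open>\<delta> > -1\<close> that makes the claimed identity hold\<close>
  define \<delta> where "\<delta> = exp (A / real n) - 1"
  have "(1 + \<delta>) ^ n = exp A"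
    using assms(2) by (simp add: \<delta>_def flip: exp_of_nat_mult)
  then have "E = (1 + \<delta>) ^ n * exp (\<Sum>r = 1..m. K r)"
    using Epos by (simp add: A_def flip: exp_add)
  moreover have "\<delta> > -1" by (simp add: \<delta>_def)
  moreover have "\<bar>\<delta>\<bar> \<le> exp ((100 * \<alpha>) ^ (m + 1)) - 1"
    unfolding \<delta>_def by (rule abs_exp_minus_1_le[OF An])
  moreover have "\<bar>cumulant M fX r\<bar> \<le> real n * (fact (r - 1) / (50 * real r)) * (80 * \<alpha>) ^ r"
    if r: "r \<in> {2..m}" for r
  proof -
    have fr: "fact r = real r * fact (r - 1)"
      using r by (simp add: fact_reduce)
    have "\<bar>cumulant M fX r\<bar> = fact r * \<bar>K r\<bar>"
      by (simp add: K_def)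
    also have "\<dots> \<le> fact r * (real n / 50 * (16 * \<alpha>) ^ r)"
      using Kbound[of r] r by (intro mult_left_mono) auto
    also have "\<dots> = real n * (fact (r - 1) / (50 * real r)) * (16 * \<alpha>) ^ r * real r ^ 2"
      using r by (simp add: fr power2_eq_square field_simps)
    \<comment> \<open>the slack between \<open>16\<close> and \<open>80\<close> absorbs \<open>r^2\<close>\<close>
    also have "\<dots> \<le> real n * (fact (r - 1) / (50 * real r)) * (16 * \<alpha>) ^ r * 5 ^ r"
      using assms(5) by (intro mult_left_mono square_le_5_power) auto
    also have "\<dots> = real n * (fact (r - 1) / (50 * real r)) * (80 * \<alpha>) ^ r"
      by (simp add: power_mult_distrib flip: mult.assoc) (simp add: mult.assoc flip: power_mult_distrib)
    finally show ?thesis .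
  qed
  ultimately show ?thesis
    unfolding E_def K_def by blast
qed

end
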